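(* Let $\mathcal{S}$ be a smooth strictly convex surface, let $p\in\mathcal{S}$, and let $\beta(\psi)=X(R(\psi),\psi)$ be the parametrization of the conjugate locus of $p$ by the initial angle $\psi$ of the radial geodesics from $p$. At every $\psi$ with $R'(\psi)\neq0$, the geodesic curvature of $\beta$, taken with respect to the unit tangent $T(R(\psi),\psi)$ and unit normal $N(R(\psi),\psi)$ of the radial geodesic, is $$ k_g(\psi)=\frac{\xi_{,s}(R(\psi),\psi)}{R'(\psi)}, $$ where $\xi_{,s}=\partial\xi/\partial s$.
   Context: A smooth strictly convex surface is a compact connected $C^\infty$ surface $\mathcal{S}$ without boundary, embedded in $\mathbb{R}^3$ as the boundary of a convex body, with Gauss curvature $K>0$ everywhere. For an angle $\psi$ measured from a fixed direction in $T_p\mathcal{S}$ let $\Gamma_\psi$ be the unit speed geodesic with $\Gamma_\psi(0)=p$ and $\Gamma_\psi'(0)$ at angle $\psi$ to the fixed direction, and set $X(s,\psi)=\Gamma_\psi(s)$. Let $T=\partial X/\partial s$ be the unit tangent of $\Gamma_\psi$ and $N$ the unit normal field along $\Gamma_\psi$ (tangent to $\mathcal{S}$, orthogonal to $T$, parallel along $\Gamma_\psi$), with sign chosen so that the Jacobi field is $\partial X/\partial\psi=\xi N$, where $\xi=\xi(s,\psi)$ solves the scalar Jacobi equation $\xi_{ss}+K\xi=0$ ($K$ evaluated at $\Gamma_\psi(s)$) with $\xi(0,\psi)=0$, $\xi_{,s}(0,\psi)=1$. The distance function $R(\psi)$ is the first positive zero of $s\mapsto\xi(s,\psi)$; it is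 smooth in $\psi$. The conjugate locus $\beta$ satisfies $\beta'(\psi)=R'(\psi)\,T(R(\psi),\psi)$. The geodesic curvature $k_g$ with respect to $(T,N)$ is defined by the Frenet equation $\frac{D}{d\sigma}T=k_g N$ along $\beta$, where $D$ denotes covariant differentiation in $\mathcal{S}$ along $\beta$ and $\sigma$ is the (signed) arc-length of $\beta$ with $d\sigma/d\psi=R'(\psi)$, so that $d\beta/d\sigma=T$. *)

theory Defs
  imports "HOL-Analysis.Analysis"
begin

section \<open>Smooth embedded surfaces in Euclidean 3-space\<close>

text \<open>\<open>Ck_on k f U\<close> is meant for open \<open>U\<close>: all partial derivatives of \<open>f\<close> of order at most
  \<open>k\<close> exist and are continuous on \<open>U\<close>.\<close>

primrec Ck_on :: "nat \<Rightarrow> ('a::euclidean_space \<Rightarrow> 'b::real_normed_vector) \<Rightarrow> 'a set \<Rightarrow> bool" where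
  "Ck_on 0 = (\<lambda>f U. continuous_on U f)"
| "Ck_on (Suc k) = (\<lambda>f U. (\<forall>x\<in>U. f differentiable (at x)) \<and>
     (\<forall>b\<in>Basis. Ck_on k (\<lambda>x. frechet_derivative f (at x) b) U))"

definition smooth_on :: "('a::euclidean_space \<Rightarrow> 'b::real_normed_vector) \<Rightarrow> 'a set \<Rightarrow> bool" where
  "smooth_on f U \<longleftrightarrow> (\<forall>k. Ck_on k f U)"

text \<open>Embedded 2-dimensional submanifold without boundary, by slice charts: near each of its points
  \<open>S\<close> is flattened to the plane \<open>x\<^sub>3 = 0\<close> by a diffeomorphism of open sets of space.\<close>

definition smooth_surface :: "(real^3) set \<Rightarrow> bool" where
  "smooth_surface S \<longleftrightarrow> (\<forall>p\<in>S. \<exists>U V (\<Phi> :: real^3 \<Rightarrow> real^3) (\<Psi> :: real^3 \<Rightarrow> real^3).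
     open U \<and> p \<in> U \<and> open V \<and>
     smooth_on \<Phi> U \<and> smooth_on \<Psi> V \<and> \<Phi> ` U = V \<and> \<Psi> ` V = U \<and>
     (\<forall>x\<in>U. \<Psi> (\<Phi> x) = x) \<and> (\<forall>y\<in>V. \<Phi> (\<Psi> y) = y) \<and>
     S \<inter> U = {x \<in> U. \<Phi> x $ 3 = 0})"

definition tangent_space :: "(real^3) set \<Rightarrow> real^3 \<Rightarrow> (real^3) set" where
  "tangent_space S p = {v. \<exists>c e. e > 0 \<and> (\<forall>t. \<bar>t\<bar> < e \<longrightarrow> c t \<in> S) \<and> c (0::real) = p \<and>
     (c has_vector_derivative v) (at 0)}"

text \<open>The Gauss curvature at \<open>p\<close> is the determinant of the differential of a local unit normal field
  \<open>n\<close>, restricted to the tangent plane and written in an orthonormal basis \<open>a, b\<close> of it. A derivative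
  within \<open>S\<close> is determined only on the tangent plane, and only there is it used; differentiability
  at \<open>p\<close> excludes sign jumps of \<open>n\<close> near \<open>p\<close>.\<close>

definition has_gauss_curvature :: "(real^3) set \<Rightarrow> real^3 \<Rightarrow> real \<Rightarrow> bool" where
  "has_gauss_curvature S p k \<longleftrightarrow> (\<exists>(n :: real^3 \<Rightarrow> real^3) A U a b. open U \<and> p \<in> U \<and>
     (\<forall>x\<in>S \<inter> U. norm (n x) = 1 \<and> (\<forall>v\<in>tangent_space S x. n x \<bullet> v = 0)) \<and>
     (n has_derivative A) (at p within S) \<and>
     a \<in> tangent_space S p \<and> b \<in> tangent_space S p \<and> norm a = 1 \<and> norm b = 1 \<and> a \<bullet> b = 0 \<and>
     k = (A a \<bullet> a) * (A b \<bullet> b) - (A a \<bullet> b) * (A b \<bullet> a))"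

definition gauss_curvature :: "(real^3) set \<Rightarrow> real^3 \<Rightarrow> real" where
  "gauss_curvature S p = (THE k. has_gauss_curvature S p k)"

definition smooth_strictly_convex_surface :: "(real^3) set \<Rightarrow> bool" where
  "smooth_strictly_convex_surface S \<longleftrightarrow> compact S \<and> connected S \<and> smooth_surface S \<and>
     (\<exists>C. convex C \<and> compact C \<and> interior C \<noteq> {} \<and> S = frontier C) \<and>
     (\<forall>x\<in>S. gauss_curvature S x > 0)"

section \<open>Covariant differentiation, geodesics, geodesic curvature\<close>

text \<open>The covariant derivative along \<open>c\<close> of a field \<open>V\<close> is the orthogonal projection of its ordinary
  derivative to the tangent plane.\<close>

definition has_covariant_derivative ::
    "(real^3) set \<Rightarrow> (real \<Rightarrow> real^3) \<Rightarrow> (real \<Rightarrow> real^3) \<Rightarrow> real \<Rightarrow> real^3 \<Rightarrow> bool" where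
  "has_covariant_derivative S c V t D \<longleftrightarrow> (\<exists>w. (V has_vector_derivative w) (at t) \<and>
     D \<in> tangent_space S (c t) \<and> (\<forall>v\<in>tangent_space S (c t). (w - D) \<bullet> v = 0))"

definition parallel_along :: "(real^3) set \<Rightarrow> (real \<Rightarrow> real^3) \<Rightarrow> (real \<Rightarrow> real^3) \<Rightarrow> bool" where
  "parallel_along S c V \<longleftrightarrow> (\<forall>t. has_covariant_derivative S c V t 0)"

definition unit_speed_geodesic :: "(real^3) set \<Rightarrow> (real \<Rightarrow> real^3) \<Rightarrow> bool" where
  "unit_speed_geodesic S c \<longleftrightarrow>
     (\<forall>s. c s \<in> S \<and> c differentiable (at s) \<and> norm (vector_derivative c (at s)) = 1) \<and>
     parallel_along S c (\<lambda>s. vector_derivative c (at s))"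

definition scalar_jacobi :: "(real^3) set \<Rightarrow> (real \<Rightarrow> real^3) \<Rightarrow> (real \<Rightarrow> real) \<Rightarrow> bool" where
  "scalar_jacobi S c f \<longleftrightarrow> (\<forall>s. f differentiable (at s) \<and>
     (deriv f has_real_derivative - gauss_curvature S (c s) * f s) (at s))"

definition is_first_positive_zero :: "(real \<Rightarrow> real) \<Rightarrow> real \<Rightarrow> bool" where
  "is_first_positive_zero f r \<longleftrightarrow> r > 0 \<and> f r = 0 \<and> (\<forall>s. 0 < s \<and> s < r \<longrightarrow> f s \<noteq> 0)"

text \<open>\<open>\<sigma>\<close> is a signed arc-length of \<open>c\<close> with \<open>dc/d\<sigma> = T\<close>, where \<open>T\<close> is a unit field that may point
  against the direction in which the parameter of \<open>c\<close> increases; \<open>k\<close> satisfies the Frenet equation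
  \<open>DT/d\<sigma> = k N\<close>, with \<open>D/d\<sigma> = (d\<sigma>/dt)\<^sup>-\<^sup>1 D/dt\<close>.\<close>

definition has_geodesic_curvature ::
    "(real^3) set \<Rightarrow> (real \<Rightarrow> real^3) \<Rightarrow> (real \<Rightarrow> real^3) \<Rightarrow> (real \<Rightarrow> real^3) \<Rightarrow>
     (real \<Rightarrow> real) \<Rightarrow> real \<Rightarrow> real \<Rightarrow> bool" where
  "has_geodesic_curvature S c T N \<sigma> t k \<longleftrightarrow> (\<exists>\<sigma>' D. (\<sigma> has_real_derivative \<sigma>') (at t) \<and> \<sigma>' \<noteq> 0 \<and>
     (c has_vector_derivative \<sigma>' *\<^sub>R T t) (at t) \<and>
     has_covariant_derivative S c T t D \<and> D /\<^sub>R \<sigma>' = k *\<^sub>R N t)"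

end

(* Differentiating T(R(psi), psi) gives R' T_s + T_psi, where T_s is normal to S and
   T_psi = X_(s psi) = (xi N)_s = xi_s N + xi N_s = xi_s N because xi vanishes at R(psi);
   dividing by R' yields the claim.

   X is not assumed to be jointly smooth, so both the chain rule and the exchange of partial
   derivatives need an argument. The exchange holds as soon as (xi N)_s is continuous in s
   uniformly in psi, since then the difference quotients of X in s converge together with their
   psi-derivatives; no continuity in psi of xi or N is needed. The uniformity comes from
   the equation V_s = - (V . H T / |nu|^2) nu for parallel fields V, with nu a local C^1 normal field
   and H its derivative, and from an energy estimate for the Jacobi equation, which requires only
   that the Gauss curvature is bounded on S. *)
theory Submission
  imports Defs
begin

section \<open>Families of curves that are uniformly differentiable\<close>

text \<open>The mean value inequality applies to \<open>F s x - (s - s0) *\<^sub>R G s0 x\<close>,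
  whose derivative \<open>G s x - G s0 x\<close> is small near \<open>s0\<close>. Uniformity of the
  limit makes \<open>d\<close> independent of \<open>x\<close>, so that \<open>x\<close> may later
  vary together with \<open>s\<close>.\<close>

lemma uniform_linearization:
  fixes F G :: "real \<Rightarrow> 'a \<Rightarrow> 'b::real_normed_vector"
  assumes der: "\<And>s x. x \<in> A \<Longrightarrow> ((\<lambda>s. F s x) has_vector_derivative G s x) (at s)"
    and lim: "uniform_limit A G (G s0) (at s0)" and e: "e > 0"
  obtains d where "d > 0"
    "\<And>s x. \<bar>s - s0\<bar> < d \<Longrightarrow> x \<in> A \<Longrightarrow> norm (F s x - F s0 x - (s - s0) *\<^sub>R G s0 x) \<le> e * \<bar>s - s0\<bar>"
proof -
  from uniform_limitD[OF lim e] obtain d where d: "d > 0"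
    "\<And>s x. s \<noteq> s0 \<Longrightarrow> dist s s0 < d \<Longrightarrow> x \<in> A \<Longrightarrow> dist (G s x) (G s0 x) < e"
    unfolding eventually_at by auto
  have "norm (F s x - F s0 x - (s - s0) *\<^sub>R G s0 x) \<le> norm (s - s0) * e"
    if s: "\<bar>s - s0\<bar> < d" and x: "x \<in> A" for s x
  proof (rule vector_differentiable_bound_linearization[where S = "ball s0 d" and f' = "\<lambda>s. G s x"])
    show "((\<lambda>s. F s x) has_vector_derivative G t x) (at t within ball s0 d)" for t
      by (rule has_vector_derivative_at_within[OF der[OF x]])
    show "closed_segment s0 s \<subseteq> ball s0 d"
      using s d(1) by (intro closed_segment_subset) (auto simp: dist_real_def)
    show "norm (G t x - G s0 x) \<le> e" if "t \<in> ball s0 d" for t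
      using d(2)[of t x] that x e by (cases "t = s0") (auto simp: dist_commute dist_norm norm_minus_commute)
  qed (use d in auto)
  with d(1) that show ?thesis by (simp add: mult.commute)
qed

lemma has_vector_derivative_bound:
  fixes f :: "real \<Rightarrow> 'b::real_normed_vector"
  assumes der: "\<And>t. t \<in> ball s0 r \<Longrightarrow> (f has_vector_derivative f' t) (at t)"
    and bd: "\<And>t. t \<in> ball s0 r \<Longrightarrow> norm (f' t) \<le> B" and s: "s \<in> ball s0 r"
  shows "norm (f s - f s0) \<le> B * \<bar>s - s0\<bar>"
proof -
  have "norm (f s - f s0) \<le> B * norm (s - s0)"
  proof (rule differentiable_bound[where S = "ball s0 r" and f' = "\<lambda>t h. h *\<^sub>R f' t"])
    show "(f has_derivative (\<lambda>h. h *\<^sub>R f' t)) (at t within ball s0 r)" if "t \<in> ball s0 r" for t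
      using has_vector_derivative_at_within[OF der[OF that]] by (simp add: has_vector_derivative_def)
    show "onorm (\<lambda>h. h *\<^sub>R f' t) \<le> B" if "t \<in> ball s0 r" for t
    proof (rule onorm_le)
      show "norm (h *\<^sub>R f' t) \<le> B * norm h" for h :: real
        using mult_left_mono[OF bd[OF that], of "\<bar>h\<bar>"] by (simp add: mult.commute)
    qed
    show "s0 \<in> ball s0 r" using s zero_le_dist[of s0 s] by (simp del: zero_le_dist)
  qed (use s in auto)
  then show ?thesis by simp
qed

text \<open>The members of the family share the Lipschitz constant \<open>B\<close> near
  \<open>s0\<close>.\<close>

lemma bounded_derivative_uniform_limit:
  fixes F G :: "real \<Rightarrow> 'a \<Rightarrow> 'b::real_normed_vector"
  assumes der: "\<And>s x. x \<in> A \<Longrightarrow> ((\<lambda>s. F s x) has_vector_derivative G s x) (at s)"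
    and bd: "\<And>s x. \<bar>s - s0\<bar> < r \<Longrightarrow> x \<in> A \<Longrightarrow> norm (G s x) \<le> B" and r: "r > 0"
  shows "uniform_limit A F (F s0) (at s0)"
proof (rule uniform_limitI)
  fix e :: real assume e: "e > 0"
  \<comment> \<open>No sign of \<open>B\<close> is known, as \<open>A\<close> may be empty;
    \<open>\<bar>B\<bar> + 1\<close> is a positive divisor in any case.\<close>
  define d where "d = min r (e / (\<bar>B\<bar> + 1))"
  have d: "d > 0" using r e by (auto simp: d_def)
  have "dist (F s x) (F s0 x) < e" if s: "\<bar>s - s0\<bar> < d" and x: "x \<in> A" for s x
  proof -
    have "norm (F s x - F s0 x) \<le> B * \<bar>s - s0\<bar>"
      using s by (intro has_vector_derivative_bound[where r = r and f' = "\<lambda>t. G t x"] der bd x)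
        (auto simp: d_def dist_real_def abs_minus_commute)
    also have "\<dots> \<le> (\<bar>B\<bar> + 1) * \<bar>s - s0\<bar>" by (intro mult_right_mono) auto
    also have "\<dots> < e" using s by (simp add: d_def pos_less_divide_eq mult.commute)
    finally show ?thesis by (simp add: dist_norm)
  qed
  then show "\<forall>\<^sub>F s in at s0. \<forall>x\<in>A. dist (F s x) (F s0 x) < e"
    unfolding eventually_at using d by (auto simp: dist_real_def)
qed

lemma uniform_limit_Pair:
  assumes f: "uniform_limit A f f' F" and g: "uniform_limit A g g' F"
  shows "uniform_limit A (\<lambda>s x. (f s x, g s x)) (\<lambda>x. (f' x, g' x)) F"
proof (rule uniform_limitI)
  fix e :: real assume "e > 0"
  then have e: "e / 2 > 0" by simp
  show "\<forall>\<^sub>F s in F. \<forall>x\<in>A. dist (f s x, g s x) (f' x, g' x) < e"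
    using uniform_limitD[OF f e] uniform_limitD[OF g e]
  proof eventually_elim
    case (elim s)
    show ?case
    proof
      fix x assume "x \<in> A"
      then have "dist (f s x) (f' x) < e / 2" "dist (g s x) (g' x) < e / 2" using elim by auto
      then show "dist (f s x, g s x) (f' x, g' x) < e"
        using sqrt_sum_squares_le_sum_abs[of "dist (f s x) (f' x)" "dist (g s x) (g' x)"]
        by (simp add: dist_Pair_Pair)
    qed
  qed
qed

text \<open>The difference quotients of \<open>X\<close> in \<open>s\<close> converge to
  \<open>T\<close>. Their \<theta>-derivatives are the difference quotients of \<open>Y\<close>,
  which converge to \<open>D s0\<close> uniformly on the ball by
  \<open>uniform_linearization\<close>. Such a limit may be differentiated termwise.\<close>

lemma mixed_partial_derivative:
  fixes X Y D :: "real \<Rightarrow> real \<Rightarrow> 'b::banach"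
  assumes X: "\<And>s \<theta>. ((\<lambda>\<theta>. X s \<theta>) has_vector_derivative Y s \<theta>) (at \<theta>)"
    and Y: "\<And>s \<theta>. ((\<lambda>s. Y s \<theta>) has_vector_derivative D s \<theta>) (at s)"
    and T: "\<And>\<theta>. ((\<lambda>s. X s \<theta>) has_vector_derivative T \<theta>) (at s0)"
    and lim: "uniform_limit (ball \<psi> d) D (D s0) (at s0)" and d: "d > 0"
  shows "(T has_vector_derivative D s0 \<psi>) (at \<psi>)"
proof -
  \<comment> \<open>The \<open>s\<close>-derivative of \<open>X\<close> is known to exist, so one
    sequence of positive steps tending to 0 recovers it. \<open>Suc\<close> keeps the first step
    nonzero, since \<open>inverse 0 = 0\<close>.\<close>
  let ?h = "\<lambda>n. inverse (real (Suc n))"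
  let ?f = "\<lambda>n \<theta>. (X (s0 + ?h n) \<theta> - X s0 \<theta>) /\<^sub>R ?h n"
  let ?f' = "\<lambda>n \<theta> k. k *\<^sub>R ((Y (s0 + ?h n) \<theta> - Y s0 \<theta>) /\<^sub>R ?h n)"
  have h0: "?h \<longlonglongrightarrow> 0" by (rule LIMSEQ_inverse_real_of_nat)
  have lim_f: "(\<lambda>n. ?f n \<theta>) \<longlonglongrightarrow> T \<theta>" for \<theta>
  proof -
    have "((\<lambda>y. (X y \<theta> - X s0 \<theta> - (y - s0) *\<^sub>R T \<theta>) /\<^sub>R \<bar>y - s0\<bar>) \<longlongrightarrow> 0) (at s0)"
      using T[of \<theta>] by (simp add: has_vector_derivative_def has_derivative_at_within)
    moreover have "filterlim (\<lambda>n. s0 + ?h n) (at s0) sequentially"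
      using tendsto_add[OF tendsto_const[of s0] h0] by (auto simp: filterlim_at)
    ultimately have "(\<lambda>n. (X (s0 + ?h n) \<theta> - X s0 \<theta> - ?h n *\<^sub>R T \<theta>) /\<^sub>R ?h n) \<longlonglongrightarrow> 0"
      by (auto dest: filterlim_compose)
    from tendsto_add[OF this tendsto_const[of "T \<theta>"]] show ?thesis
      by (simp add: scaleR_diff_right del: of_nat_Suc)
  qed
  have "\<exists>g. \<forall>\<theta>\<in>ball \<psi> d. (\<lambda>n. ?f n \<theta>) \<longlonglongrightarrow> g \<theta> \<and>
      (g has_derivative (\<lambda>k. k *\<^sub>R D s0 \<theta>)) (at \<theta> within ball \<psi> d)"
  proof (rule has_derivative_sequence[where f' = ?f'])
    show "(?f n has_derivative ?f' n \<theta>) (at \<theta> within ball \<psi> d)" for n \<theta>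
      unfolding has_vector_derivative_def[symmetric]
      by (rule has_vector_derivative_at_within) (auto intro!: derivative_eq_intros X)
    show "(\<lambda>n. ?f n \<psi>) \<longlonglongrightarrow> T \<psi>" by (rule lim_f)
    fix e :: real assume e: "e > 0"
    obtain \<delta> where \<delta>: "\<delta> > 0" "\<And>s \<theta>. \<bar>s - s0\<bar> < \<delta> \<Longrightarrow> \<theta> \<in> ball \<psi> d \<Longrightarrow>
        norm (Y s \<theta> - Y s0 \<theta> - (s - s0) *\<^sub>R D s0 \<theta>) \<le> e * \<bar>s - s0\<bar>"
      using uniform_linearization[OF Y lim e] by blast
    have "\<forall>\<^sub>F n in sequentially. ?h n < \<delta>"
      using h0 \<delta>(1) by (rule order_tendstoD)
    then show "\<forall>\<^sub>F n in sequentially. \<forall>\<theta>\<in>ball \<psi> d. \<forall>k.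
        norm (?f' n \<theta> k - k *\<^sub>R D s0 \<theta>) \<le> e * norm k"
    proof eventually_elim
      case (elim n)
      show ?case
      proof (intro ballI allI)
        fix \<theta> k assume \<theta>: "\<theta> \<in> ball \<psi> d"
        let ?v = "Y (s0 + ?h n) \<theta> - Y s0 \<theta>"
        have "?f' n \<theta> k - k *\<^sub>R D s0 \<theta> = (k / ?h n) *\<^sub>R (?v - ?h n *\<^sub>R D s0 \<theta>)"
          by (simp add: scaleR_diff_right divide_inverse)
        then have "norm (?f' n \<theta> k - k *\<^sub>R D s0 \<theta>) =
            (\<bar>k\<bar> / ?h n) * norm (?v - ?h n *\<^sub>R D s0 \<theta>)"
          by (simp add: abs_mult)
        also have "\<dots> \<le> (\<bar>k\<bar> / ?h n) * (e * ?h n)"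
          using \<delta>(2)[of "s0 + ?h n" \<theta>] elim \<theta> by (intro mult_left_mono) auto
        finally show "norm (?f' n \<theta> k - k *\<^sub>R D s0 \<theta>) \<le> e * norm k"
          by (simp add: field_simps del: of_nat_Suc)
      qed
    qed
  qed (use d in auto)
  then obtain g where g: "\<And>\<theta>. \<theta> \<in> ball \<psi> d \<Longrightarrow> (\<lambda>n. ?f n \<theta>) \<longlonglongrightarrow> g \<theta>"
    "\<And>\<theta>. \<theta> \<in> ball \<psi> d \<Longrightarrow> (g has_vector_derivative D s0 \<theta>) (at \<theta> within ball \<psi> d)"
    unfolding has_vector_derivative_def by blast
  \<comment> \<open>Termwise differentiation only yields some limit function \<open>g\<close>;
    uniqueness of limits identifies it with \<open>T\<close> on the ball.\<close>
  have "g \<theta> = T \<theta>" if "\<theta> \<in> ball \<psi> d" for \<theta>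
    using LIMSEQ_unique[OF g(1)[OF that] lim_f] .
  moreover have "(g has_vector_derivative D s0 \<psi>) (at \<psi>)"
    using g(2)[of \<psi>] d at_within_open[of \<psi> "ball \<psi> d"] by simp
  ultimately show ?thesis
    using has_vector_derivative_transform_within_open[of g _ \<psi> "ball \<psi> d" T] d by auto
qed

text \<open>A chain rule at the single point \<psi> without joint differentiability of
  \<open>F\<close>: differentiability in \<open>s\<close> uniform in \<theta> is combined with the
  \<theta>-derivative on the line \<open>s = R \<psi>\<close>.\<close>

lemma derivative_along_graph:
  fixes F G :: "real \<Rightarrow> real \<Rightarrow> 'b::real_normed_vector"
  assumes der: "\<And>s \<theta>. ((\<lambda>s. F s \<theta>) has_vector_derivative G s \<theta>) (at s)"
    and lim: "uniform_limit (ball \<psi> d) G (G (R \<psi>)) (at (R \<psi>))" and d: "d > 0"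
    and cont: "isCont (G (R \<psi>)) \<psi>"
    and E: "(F (R \<psi>) has_vector_derivative E) (at \<psi>)"
    and R: "(R has_real_derivative R') (at \<psi>)"
  shows "((\<lambda>\<theta>. F (R \<theta>) \<theta>) has_vector_derivative R' *\<^sub>R G (R \<psi>) \<psi> + E) (at \<psi>)"
proof -
  \<comment> \<open>The remainder has two sources: linearizing in \<open>s\<close> at \<theta>, and
    replacing \<open>G (R \<psi>) \<theta>\<close> by \<open>G (R \<psi>) \<psi>\<close>. Both are
    small multiples of the increment of \<open>R\<close>.\<close>
  define \<rho> where "\<rho> \<theta> = F (R \<theta>) \<theta> - F (R \<psi>) \<theta> - (R \<theta> - R \<psi>) *\<^sub>R G (R \<psi>) \<psi>" for \<theta>
  have "(\<rho> has_vector_derivative 0) (at \<psi>)"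
    unfolding has_vector_derivative_def has_derivative_at_alt
  proof (intro conjI allI impI)
    fix e :: real assume e: "e > 0"
    \<comment> \<open>Each of the two errors is at most
      \<open>e' * \<bar>R \<theta> - R \<psi>\<bar>\<close>, and near \<psi> this increment is at
      most \<open>(\<bar>R'\<bar> + 1) * \<bar>\<theta> - \<psi>\<bar>\<close>.\<close>
    define e' where "e' = e / (2 * (\<bar>R'\<bar> + 1))"
    have e': "e' > 0" using e by (simp add: e'_def add_nonneg_pos)
    obtain d1 where d1: "d1 > 0" "\<And>s \<theta>. \<bar>s - R \<psi>\<bar> < d1 \<Longrightarrow> \<theta> \<in> ball \<psi> d \<Longrightarrow>
        norm (F s \<theta> - F (R \<psi>) \<theta> - (s - R \<psi>) *\<^sub>R G (R \<psi>) \<theta>) \<le> e' * \<bar>s - R \<psi>\<bar>"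
      using uniform_linearization[OF der lim e'] by blast
    obtain d2 where d2: "d2 > 0" "\<And>\<theta>. \<bar>\<theta> - \<psi>\<bar> < d2 \<Longrightarrow> norm (G (R \<psi>) \<theta> - G (R \<psi>) \<psi>) < e'"
      using cont e' unfolding continuous_at_eps_delta dist_norm by (metis real_norm_def)
    obtain d3 where d3: "d3 > 0" "\<And>\<theta>. \<bar>\<theta> - \<psi>\<bar> < d3 \<Longrightarrow> \<bar>R \<theta> - R \<psi>\<bar> < d1"
      using DERIV_isCont[OF R] d1(1) unfolding continuous_at_eps_delta dist_real_def by metis
    obtain d4 where d4: "d4 > 0" "\<And>\<theta>. \<bar>\<theta> - \<psi>\<bar> < d4 \<Longrightarrow>
        \<bar>R \<theta> - R \<psi> - R' * (\<theta> - \<psi>)\<bar> \<le> 1 * \<bar>\<theta> - \<psi>\<bar>"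
      using R unfolding has_field_derivative_def has_derivative_at_alt real_norm_def
      by (metis zero_less_one)
    show "\<exists>\<delta>>0. \<forall>\<theta>. norm (\<theta> - \<psi>) < \<delta> \<longrightarrow> norm (\<rho> \<theta> - \<rho> \<psi> - (\<theta> - \<psi>) *\<^sub>R 0) \<le> e * norm (\<theta> - \<psi>)"
    proof (intro exI[of _ "min (min d d2) (min d3 d4)"] conjI allI impI)
      fix \<theta> assume \<theta>: "norm (\<theta> - \<psi>) < min (min d d2) (min d3 d4)"
      have "norm (\<rho> \<theta>) = norm ((F (R \<theta>) \<theta> - F (R \<psi>) \<theta> - (R \<theta> - R \<psi>) *\<^sub>R G (R \<psi>) \<theta>)
          + (R \<theta> - R \<psi>) *\<^sub>R (G (R \<psi>) \<theta> - G (R \<psi>) \<psi>))"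
        by (simp add: \<rho>_def algebra_simps)
      also have "\<dots> \<le> e' * \<bar>R \<theta> - R \<psi>\<bar> + \<bar>R \<theta> - R \<psi>\<bar> * e'"
        using \<theta> d1(2)[of "R \<theta>" \<theta>] d2(2)[of \<theta>] d3(2)[of \<theta>]
        by (intro norm_triangle_mono) (auto simp: dist_real_def intro!: mult_left_mono)
      also have "\<dots> = 2 * e' * \<bar>R \<theta> - R \<psi>\<bar>" by simp
      also have "\<bar>R \<theta> - R \<psi>\<bar> \<le> \<bar>R' * (\<theta> - \<psi>)\<bar> + \<bar>\<theta> - \<psi>\<bar>"
        using d4(2)[of \<theta>] \<theta> by auto
      also have "\<dots> = (\<bar>R'\<bar> + 1) * \<bar>\<theta> - \<psi>\<bar>" by (simp only: abs_mult distrib_right mult_1)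
      also have "2 * e' * ((\<bar>R'\<bar> + 1) * \<bar>\<theta> - \<psi>\<bar>) = e * \<bar>\<theta> - \<psi>\<bar>"
        by (simp add: e'_def field_simps add_nonneg_eq_0_iff)
      finally show "norm (\<rho> \<theta> - \<rho> \<psi> - (\<theta> - \<psi>) *\<^sub>R 0) \<le> e * norm (\<theta> - \<psi>)"
        using e' by (simp add: \<rho>_def mult_left_mono)
    qed (use d d2 d3 d4 in auto)
  qed (simp add: bounded_linear_zero)
  then have "((\<lambda>\<theta>. F (R \<psi>) \<theta> + (R \<theta> - R \<psi>) *\<^sub>R G (R \<psi>) \<psi> + \<rho> \<theta>) has_vector_derivative
      R' *\<^sub>R G (R \<psi>) \<psi> + E) (at \<psi>)"
    using R by (auto intro!: derivative_eq_intros E)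
  then show ?thesis by (simp add: \<rho>_def)
qed

text \<open>Gronwall argument: the energy \<open>(f t)\<^sup>2 + (deriv f t)\<^sup>2\<close> grows
  at rate at most \<open>1 + M\<close> times itself, so damping it by
  \<open>exp (- (1 + M) * t)\<close> makes it nonincreasing; it starts at 1.\<close>

lemma scalar_jacobi_bound:
  fixes f :: "real \<Rightarrow> real"
  assumes f: "\<And>s. f differentiable (at s)"
    and f': "\<And>s. (deriv f has_real_derivative - k s * f s) (at s)"
    and k: "\<And>s. \<bar>k s\<bar> \<le> M" and init: "f 0 = 0" "deriv f 0 = 1" and s: "s \<ge> 0"
  shows "(f s)\<^sup>2 + (deriv f s)\<^sup>2 \<le> exp ((1 + M) * s)"
proof -
  define h where "h t = ((f t)\<^sup>2 + (deriv f t)\<^sup>2) * exp (- (1 + M) * t)" for t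
  have df: "(f has_real_derivative deriv f t) (at t)" for t
    using f by (simp add: DERIV_deriv_iff_real_differentiable)
  have "h s \<le> h 0"
  proof (rule DERIV_nonpos_imp_nonincreasing[OF s])
    fix t
    let ?e = "(f t)\<^sup>2 + (deriv f t)\<^sup>2"
    let ?h' = "(2 * f t * deriv f t * (1 - k t) - (1 + M) * ?e) * exp (- (1 + M) * t)"
    have "(h has_real_derivative ?h') (at t)"
      unfolding h_def
      by (auto intro!: derivative_eq_intros df f' simp: algebra_simps power2_eq_square)
    moreover have "2 * f t * deriv f t * (1 - k t) \<le> (1 + M) * ?e"
    proof -
      have "2 * f t * deriv f t * (1 - k t) \<le> \<bar>2 * f t * deriv f t\<bar> * \<bar>1 - k t\<bar>"
        by (metis abs_ge_self abs_mult)
      \<comment> \<open>Taking \<open>sum_squares_bound\<close> for \<open>f t\<close> and for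
        \<open>- f t\<close> bounds the absolute value of \<open>2 * f t * deriv f t\<close> by the
        energy.\<close>
      also have "\<dots> \<le> ?e * (1 + M)"
        using k[of t] sum_squares_bound[of "f t" "deriv f t"] sum_squares_bound[of "- f t" "deriv f t"]
        by (intro mult_mono) (auto simp: abs_if split: if_splits)
      finally show ?thesis by (simp add: mult.commute)
    qed
    ultimately show "\<exists>y. (h has_real_derivative y) (at t) \<and> y \<le> 0"
      by (intro exI[of _ ?h']) (simp add: mult_le_0_iff)
  qed
  then have "((f s)\<^sup>2 + (deriv f s)\<^sup>2) * exp (- (1 + M) * s) \<le> 1"
    by (simp add: h_def init)
  moreover have "exp (- (1 + M) * s) = inverse (exp ((1 + M) * s))"
    by (simp add: algebra_simps flip: exp_minus)
  ultimately show ?thesis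
    by (simp add: divide_inverse[symmetric])
qed

section \<open>Normal fields and the Gauss curvature of a smooth surface\<close>

lemma has_vector_derivative_transform_eventually:
  assumes "(f has_vector_derivative D) (at x)" "\<forall>\<^sub>F t in at x. f t = g t" "f x = g x"
  shows "(g has_vector_derivative D) (at x)"
  using assms has_derivative_transform_eventually[of f _ x UNIV g]
  unfolding has_vector_derivative_def by auto

text \<open>\<open>\<nu>\<close> plays the role of the gradient of the third coordinate of a slice chart and \<open>H\<close> that of
  its Hessian; \<open>\<nu>\<close> is left unnormalized, so that only two derivatives of the chart are needed.\<close>

definition normal_chart ::
    "(real^3) set \<Rightarrow> (real^3) set \<Rightarrow> (real^3 \<Rightarrow> real^3) \<Rightarrow> (real^3 \<Rightarrow> real^3 \<Rightarrow> real^3) \<Rightarrow> bool" where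
  "normal_chart S U \<nu> H \<longleftrightarrow> open U \<and> (\<forall>x\<in>U. \<nu> x \<noteq> 0 \<and> (\<nu> has_derivative H x) (at x)) \<and>
     continuous_on (U \<times> UNIV) (\<lambda>(x, v). H x v) \<and>
     (\<forall>x\<in>S \<inter> U. tangent_space S x = {v. \<nu> x \<bullet> v = 0})"

lemma normal_chartD:
  assumes "normal_chart S U \<nu> H"
  shows "open U" "\<And>x. x \<in> U \<Longrightarrow> \<nu> x \<noteq> 0" "\<And>x. x \<in> U \<Longrightarrow> (\<nu> has_derivative H x) (at x)"
    "continuous_on (U \<times> UNIV) (\<lambda>(x, v). H x v)"
    "\<And>x v. x \<in> S \<Longrightarrow> x \<in> U \<Longrightarrow> v \<in> tangent_space S x \<longleftrightarrow> \<nu> x \<bullet> v = 0"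
  using assms unfolding normal_chart_def by auto

text \<open>The third coordinate of \<Phi> vanishes along curves in \<open>S\<close>, so their
  velocities are orthogonal to its gradient. Conversely, a vector orthogonal to the gradient is the
  velocity of a straight segment in the slice pulled back by \<Psi>.\<close>

lemma smooth_surface_normal_chart:
  assumes "smooth_surface S" "q \<in> S"
  obtains U \<nu> H where "normal_chart S U \<nu> H" "q \<in> U"
proof -
  have "\<exists>U V (\<Phi> :: real^3 \<Rightarrow> real^3) (\<Psi> :: real^3 \<Rightarrow> real^3). open U \<and> q \<in> U \<and> open V \<and>
      smooth_on \<Phi> U \<and> smooth_on \<Psi> V \<and> \<Phi> ` U = V \<and> \<Psi> ` V = U \<and>
      (\<forall>x\<in>U. \<Psi> (\<Phi> x) = x) \<and> (\<forall>y\<in>V. \<Phi> (\<Psi> y) = y) \<and> S \<inter> U = {x \<in> U. \<Phi> x $ 3 = 0}"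
    using assms unfolding smooth_surface_def by (rule bspec)
  then obtain U V and \<Phi> \<Psi> :: "real^3 \<Rightarrow> real^3" where U: "open U" "q \<in> U" and V: "open V"
    and smooth: "smooth_on \<Phi> U" "smooth_on \<Psi> V" and im: "\<Phi> ` U = V" "\<Psi> ` V = U"
    and inv0: "\<forall>x\<in>U. \<Psi> (\<Phi> x) = x" "\<forall>y\<in>V. \<Phi> (\<Psi> y) = y"
    and slice: "S \<inter> U = {x \<in> U. \<Phi> x $ 3 = 0}"
    by (elim exE conjE) (rule that, assumption+)
  have inv: "\<And>x. x \<in> U \<Longrightarrow> \<Psi> (\<Phi> x) = x" "\<And>y. y \<in> V \<Longrightarrow> \<Phi> (\<Psi> y) = y"
    using inv0 by blast+
  define d\<Phi> where "d\<Phi> x = frechet_derivative \<Phi> (at x)" for x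
  define d\<Psi> where "d\<Psi> x = frechet_derivative \<Psi> (at x)" for x
  define Q where "Q b x = frechet_derivative (\<lambda>x. d\<Phi> x b) (at x)" for b x
  have "Ck_on (Suc (Suc 0)) \<Phi> U" "Ck_on (Suc 0) \<Psi> V"
    using smooth unfolding smooth_on_def by blast+
  note Ck = this[unfolded Ck_on.simps]
  have d\<Phi>: "(\<Phi> has_derivative d\<Phi> x) (at x)" if "x \<in> U" for x
    using Ck that unfolding d\<Phi>_def by (simp add: frechet_derivative_works)
  have d\<Psi>: "(\<Psi> has_derivative d\<Psi> y) (at y)" if "y \<in> V" for y
    using Ck that unfolding d\<Psi>_def by (simp add: frechet_derivative_works)
  have Q: "((\<lambda>x. d\<Phi> x b) has_derivative Q b x) (at x)" if "x \<in> U" "b \<in> Basis" for x b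
    using Ck that unfolding d\<Phi>_def Q_def by (metis frechet_derivative_works)
  have Qc: "continuous_on U (\<lambda>x. Q b x c)" if "b \<in> Basis" "c \<in> Basis" for b c
    using Ck that unfolding d\<Phi>_def Q_def by metis
  have inverse: "d\<Psi> (\<Phi> x) (d\<Phi> x v) = v \<and> d\<Phi> x (d\<Psi> (\<Phi> x) v) = v" if x: "x \<in> U" for x v
  proof
    have y: "\<Phi> x \<in> V" using im x by blast
    have "(\<Psi> \<circ> \<Phi> has_derivative d\<Psi> (\<Phi> x) \<circ> d\<Phi> x) (at x)"
      by (rule diff_chain_at[OF d\<Phi>[OF x] d\<Psi>[OF y]])
    then have "((\<lambda>x. x) has_derivative d\<Psi> (\<Phi> x) \<circ> d\<Phi> x) (at x)"
      by (rule has_derivative_transform_within_open[OF _ U(1) x]) (simp add: inv)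
    from has_derivative_unique[OF this has_derivative_ident] show "d\<Psi> (\<Phi> x) (d\<Phi> x v) = v"
      by (simp add: fun_eq_iff)
    have "(\<Phi> \<circ> \<Psi> has_derivative d\<Phi> x \<circ> d\<Psi> (\<Phi> x)) (at (\<Phi> x))"
      using diff_chain_at[OF d\<Psi>[OF y]] d\<Phi>[OF x] inv(1)[OF x] by simp
    then have "((\<lambda>x. x) has_derivative d\<Phi> x \<circ> d\<Psi> (\<Phi> x)) (at (\<Phi> x))"
      by (rule has_derivative_transform_within_open[OF _ V y]) (simp add: inv)
    from has_derivative_unique[OF this has_derivative_ident] show "d\<Phi> x (d\<Psi> (\<Phi> x) v) = v"
      by (simp add: fun_eq_iff)
  qed
  then have \<Psi>\<Phi>: "\<And>x v. x \<in> U \<Longrightarrow> d\<Psi> (\<Phi> x) (d\<Phi> x v) = v"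
    and \<Phi>\<Psi>: "\<And>x v. x \<in> U \<Longrightarrow> d\<Phi> x (d\<Psi> (\<Phi> x) v) = v" by blast+
  define \<nu> where "\<nu> x = (\<Sum>b\<in>Basis. (d\<Phi> x b $ 3) *\<^sub>R b)" for x
  define H where "H x v = (\<Sum>b\<in>Basis. (Q b x v $ 3) *\<^sub>R b)" for x v
  have \<nu>_inner: "\<nu> x \<bullet> v = d\<Phi> x v $ 3" if x: "x \<in> U" for x v
  proof -
    have lin: "linear (d\<Phi> x)" using d\<Phi>[OF x] by (rule has_derivative_linear)
    have "d\<Phi> x v = d\<Phi> x (\<Sum>b\<in>Basis. (v \<bullet> b) *\<^sub>R b)"
      by (simp only: euclidean_representation)
    also have "\<dots> = (\<Sum>b\<in>Basis. (v \<bullet> b) *\<^sub>R d\<Phi> x b)"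
      by (simp only: linear_sum[OF lin] linear_cmul[OF lin])
    finally have "d\<Phi> x v $ 3 = (\<Sum>b\<in>Basis. (v \<bullet> b) * d\<Phi> x b $ 3)"
      by (simp only: sum_component vector_scaleR_component real_scaleR_def)
    moreover have "\<nu> x \<bullet> v = (\<Sum>b\<in>Basis. d\<Phi> x b $ 3 * (b \<bullet> v))"
      by (simp only: \<nu>_def inner_sum_left inner_scaleR_left)
    ultimately show ?thesis by (simp only: inner_commute[of v] mult.commute)
  qed
  \<comment> \<open>The vector that \<open>d\<Phi> x\<close> sends to the third axis has inner
    product 1 with \<open>\<nu> x\<close>.\<close>
  have "\<nu> x \<noteq> 0" if "x \<in> U" for x
    using \<nu>_inner[OF that, of "d\<Psi> (\<Phi> x) (axis 3 1)"] \<Phi>\<Psi>[OF that] by auto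
  moreover have "(\<nu> has_derivative H x) (at x)" if "x \<in> U" for x
    unfolding \<nu>_def H_def
    by (intro has_derivative_sum has_derivative_scaleR_left
        bounded_linear.has_derivative[OF bounded_linear_vec_nth] Q that)
  moreover have "continuous_on (U \<times> UNIV) (\<lambda>(x, v). H x v)"
  proof -
    \<comment> \<open>\<open>Ck_on\<close> gives continuity of second derivatives in basis
      directions only; expanding \<open>v\<close> linearly in the basis turns this into joint
      continuity in \<open>x\<close> and \<open>v\<close>.\<close>
    have "continuous_on (U \<times> UNIV)
      (\<lambda>z. \<Sum>b\<in>Basis. ((\<Sum>c\<in>Basis. (snd z \<bullet> c) *\<^sub>R Q b (fst z) c) $ 3) *\<^sub>R b)"
      by (intro continuous_intros continuous_on_compose2[OF Qc]) auto
    moreover have "H x v = (\<Sum>b\<in>Basis. ((\<Sum>c\<in>Basis. (v \<bullet> c) *\<^sub>R Q b x c) $ 3) *\<^sub>R b)"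
      if "x \<in> U" for x v
    proof -
      have "Q b x v = (\<Sum>c\<in>Basis. (v \<bullet> c) *\<^sub>R Q b x c)" if b: "b \<in> Basis" for b
      proof -
        have lin: "linear (Q b x)" using Q[OF \<open>x \<in> U\<close> b] by (rule has_derivative_linear)
        have "Q b x v = Q b x (\<Sum>c\<in>Basis. (v \<bullet> c) *\<^sub>R c)"
          by (simp only: euclidean_representation)
        also have "\<dots> = (\<Sum>c\<in>Basis. (v \<bullet> c) *\<^sub>R Q b x c)"
          by (simp only: linear_sum[OF lin] linear_cmul[OF lin])
        finally show ?thesis .
      qed
      then show ?thesis unfolding H_def by (intro sum.cong) auto
    qed
    ultimately show ?thesis
      by (subst continuous_on_cong[OF refl]) (auto simp: case_prod_unfold)
  qed
  moreover have "tangent_space S x = {v. \<nu> x \<bullet> v = 0}" if x: "x \<in> S" "x \<in> U" for x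
  proof (intro equalityI subsetI)
    fix v assume "v \<in> tangent_space S x"
    then obtain c e where e: "e > 0" "\<And>t. \<bar>t\<bar> < e \<Longrightarrow> c t \<in> S" and c: "c (0::real) = x"
      "(c has_vector_derivative v) (at 0)"
      unfolding tangent_space_def by auto
    have "((\<lambda>t. \<Phi> (c t)) has_vector_derivative d\<Phi> x v) (at 0)"
      using vector_derivative_diff_chain_within[of c v 0 UNIV \<Phi> "d\<Phi> x"] c d\<Phi>[OF x(2)]
      by (auto simp: o_def intro: has_derivative_at_withinI)
    then have "((\<lambda>t. \<Phi> (c t) $ 3) has_vector_derivative d\<Phi> x v $ 3) (at 0)"
      by (rule bounded_linear.has_vector_derivative[OF bounded_linear_vec_nth])
    moreover have "((\<lambda>t. \<Phi> (c t) $ 3) has_vector_derivative 0) (at 0)"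
    proof -
      have "(c \<longlongrightarrow> x) (at 0)"
        using has_vector_derivative_continuous[OF c(2)] c(1) by (simp add: continuous_at)
      then have "\<forall>\<^sub>F t in at 0. c t \<in> U" using U(1) x(2) by (rule topological_tendstoD)
      moreover have "\<forall>\<^sub>F t in at 0. c t \<in> S"
        using e unfolding eventually_at by (auto simp: dist_real_def)
      ultimately have "\<forall>\<^sub>F t in at 0. 0 = \<Phi> (c t) $ 3"
        by eventually_elim (use slice in auto)
      moreover have "0 = \<Phi> (c 0) $ 3" using c(1) x slice by auto
      ultimately show ?thesis
        by (rule has_vector_derivative_transform_eventually[OF has_vector_derivative_const])
    qed
    ultimately have "d\<Phi> x v $ 3 = 0" by (rule vector_derivative_unique_at)
    then show "v \<in> {v. \<nu> x \<bullet> v = 0}" using \<nu>_inner x by simp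
  next
    fix v assume "v \<in> {v. \<nu> x \<bullet> v = 0}"
    then have w: "d\<Phi> x v $ 3 = 0" using \<nu>_inner x by simp
    \<comment> \<open>This line stays in the slice plane, because \<open>d\<Phi> x v\<close> has
      third coordinate 0; for small \<open>t\<close> it also stays in \<open>V\<close>, where \<Psi>
      carries it back to \<open>S\<close>.\<close>
    define l where "l t = \<Phi> x + t *\<^sub>R d\<Phi> x v" for t :: real
    have y: "\<Phi> x \<in> V" using im x by blast
    have dl: "(l has_vector_derivative d\<Phi> x v) (at 0)"
      unfolding l_def by (auto intro!: derivative_eq_intros)
    have "(l \<longlongrightarrow> \<Phi> x) (at 0)"
      using has_vector_derivative_continuous[OF dl] by (simp add: continuous_at l_def)
    then have "\<forall>\<^sub>F t in at 0. l t \<in> V" using V y by (rule topological_tendstoD)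
    then obtain e where e: "e > 0" "\<And>t. t \<noteq> 0 \<Longrightarrow> \<bar>t\<bar> < e \<Longrightarrow> l t \<in> V"
      unfolding eventually_at by (auto simp: dist_real_def)
    have "\<Psi> (l t) \<in> S" if t: "\<bar>t\<bar> < e" for t
    proof -
      have "l t \<in> V" using e(2)[of t] t y by (cases "t = 0") (auto simp: l_def)
      moreover have "l t $ 3 = 0" using w x slice by (auto simp: l_def)
      moreover have "\<Psi> (l t) \<in> U" using im \<open>l t \<in> V\<close> by blast
      ultimately have "\<Psi> (l t) \<in> S \<inter> U" unfolding slice by (simp add: inv(2))
      then show ?thesis by blast
    qed
    moreover have "((\<lambda>t. \<Psi> (l t)) has_vector_derivative v) (at 0)"
    proof -
      have "(\<Psi> has_derivative d\<Psi> (\<Phi> x)) (at (l 0) within range l)"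
        using has_derivative_at_withinI[OF d\<Psi>[OF y]] by (simp add: l_def)
      from vector_derivative_diff_chain_within[OF dl this] show ?thesis
        by (simp add: o_def \<Psi>\<Phi>[OF x(2)])
    qed
    moreover have "\<Psi> (l 0) = x" using inv x by (simp add: l_def)
    ultimately show "v \<in> tangent_space S x"
      unfolding tangent_space_def using e(1)
      by (intro CollectI exI[of _ "\<lambda>t. \<Psi> (l t)"] exI[of _ e]) auto
  qed
  ultimately have "normal_chart S U \<nu> H" unfolding normal_chart_def using U by auto
  then show ?thesis using that U by blast
qed

section \<open>Gauss curvature expressed by an unnormalized normal field\<close>

lemma orthonormal_pair_hyperplane:
  fixes u :: "real^3"
  assumes "u \<noteq> 0"
  obtains a b where "norm a = 1" "norm b = 1" "a \<bullet> b = 0" "u \<bullet> a = 0" "u \<bullet> b = 0"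
    "\<And>v. u \<bullet> v = 0 \<Longrightarrow> v = (v \<bullet> a) *\<^sub>R a + (v \<bullet> b) *\<^sub>R b"
proof -
  obtain B where B: "B \<subseteq> {v. u \<bullet> v = 0}" "pairwise orthogonal B" "\<And>x. x \<in> B \<Longrightarrow> norm x = 1"
    "independent B" "card B = dim {v. u \<bullet> v = 0}" "span B = {v. u \<bullet> v = 0}"
    using orthonormal_basis_subspace[OF subspace_hyperplane] by metis
  have "card B = 2" using B(5) dim_hyperplane[OF assms] by simp
  then obtain a b where ab: "B = {a, b}" "a \<noteq> b" by (auto simp: card_2_iff)
  have 1: "norm a = 1" "norm b = 1" "u \<bullet> a = 0" "u \<bullet> b = 0" using B ab by auto
  have 2: "a \<bullet> b = 0" using B(2) ab by (auto simp: pairwise_def orthogonal_def)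
  have "v = (v \<bullet> a) *\<^sub>R a + (v \<bullet> b) *\<^sub>R b" if "u \<bullet> v = 0" for v
  proof -
    have "v \<in> span {a, b}" using B(6) ab that by simp
    then obtain k where "v - k *\<^sub>R a \<in> span {b}" by (auto simp: span_insert)
    then obtain l where "v - k *\<^sub>R a = l *\<^sub>R b" by (auto simp: span_singleton)
    then have v: "v = k *\<^sub>R a + l *\<^sub>R b" by (simp add: algebra_simps)
    have "a \<bullet> a = 1" "b \<bullet> b = 1" using 1 by (simp_all add: norm_eq_1)
    then have "v \<bullet> a = k" "v \<bullet> b = l" using 2 by (simp_all add: v inner_add_left inner_commute[of b a])
    then show ?thesis using v by simp
  qed
  with 1 2 that show ?thesis by blast
qed

text \<open>On \<open>S\<close> every unit normal field is \<open>n = \<mu> \<nu>\<close> for a scalar \<open>\<mu>\<close>, so its derivative is \<open>\<mu> H\<close> up to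
  a multiple of \<open>\<nu>\<close>. Only \<open>\<mu>\<^sup>2\<close> enters the Gauss curvature, hence its sign is irrelevant.\<close>

lemma unit_normal_derivative_in_chart:
  assumes chart: "normal_chart S U \<nu> H" and x: "x \<in> S" "x \<in> U"
    and U': "open U'" "x \<in> U'"
    and n: "\<forall>y\<in>S \<inter> U'. norm (n y) = 1 \<and> (\<forall>v\<in>tangent_space S y. n y \<bullet> v = 0)"
    and A: "(n has_derivative A) (at x within S)"
    and v: "v \<in> tangent_space S x" and w: "w \<in> tangent_space S x"
  shows "A v \<bullet> w = (H x v \<bullet> w) * ((n x \<bullet> \<nu> x) / (\<nu> x \<bullet> \<nu> x))"
    and "((n x \<bullet> \<nu> x) / (\<nu> x \<bullet> \<nu> x))\<^sup>2 = 1 / (\<nu> x \<bullet> \<nu> x)"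
proof -
  note chartD = normal_chartD[OF chart]
  define \<mu> where "\<mu> y = (n y \<bullet> \<nu> y) / (\<nu> y \<bullet> \<nu> y)" for y
  have n_eq: "n y = \<mu> y *\<^sub>R \<nu> y" if y: "y \<in> S" "y \<in> U" "y \<in> U'" for y
  proof -
    \<comment> \<open>The part of \<open>n y\<close> orthogonal to \<open>\<nu> y\<close> is
      tangent, hence orthogonal to \<open>n y\<close> as well, hence to itself.\<close>
    define z where "z = n y - \<mu> y *\<^sub>R \<nu> y"
    have "\<nu> y \<bullet> \<nu> y \<noteq> 0" using chartD(2)[OF y(2)] by simp
    then have z: "\<nu> y \<bullet> z = 0"
      by (simp add: z_def \<mu>_def inner_diff_right inner_commute)
    then have "z \<in> tangent_space S y" using chartD(5) y by blast
    then have "n y \<bullet> z = 0" using n y by blast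
    then have "z \<bullet> z = 0"
      using z by (metis z_def inner_diff_left inner_scaleR_left diff_zero mult_zero_right)
    then show ?thesis by (simp add: z_def)
  qed
  from v obtain c e where e: "e > 0" "\<And>t. \<bar>t\<bar> < e \<Longrightarrow> c t \<in> S" and c: "c (0::real) = x"
      "(c has_vector_derivative v) (at 0)"
    unfolding tangent_space_def by auto
  have cx: "isCont c 0" using has_vector_derivative_continuous[OF c(2)] .
  have zero: "(0::real) \<in> {-e<..<e}" "open {-e<..<e}" using e by auto
  have cS: "c ` {-e<..<e} \<subseteq> S" using e(2) by (auto simp: abs_less_iff)
  \<comment> \<open>\<open>n\<close> is differentiable only within \<open>S\<close>, so the chain
    rule is applied on an interval that \<open>c\<close> maps into \<open>S\<close>; openness of the
    interval then removes the restriction.\<close>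
  have "((\<lambda>t. n (c t)) has_vector_derivative A v) (at 0 within {-e<..<e})"
    using vector_derivative_diff_chain_within[of c v 0 "{-e<..<e}" n A] c
      has_derivative_subset[OF A cS]
    by (auto simp: o_def intro: has_vector_derivative_at_within)
  then have nc: "((\<lambda>t. n (c t)) has_vector_derivative A v) (at 0)"
    using at_within_open[OF zero] by simp
  have \<nu>c: "((\<lambda>t. \<nu> (c t)) has_vector_derivative H x v) (at 0)"
    using vector_derivative_diff_chain_within[of c v 0 UNIV \<nu> "H x"] c chartD(3)[OF x(2)]
    by (auto simp: o_def intro: has_derivative_at_withinI)
  have \<nu>0: "\<nu> x \<bullet> \<nu> x \<noteq> 0" using chartD(2)[OF x(2)] by simp
  \<comment> \<open>The derivative of \<mu> along \<open>c\<close> only has to exist: it contributes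
    a multiple of \<open>\<nu> x\<close>, which disappears in the inner product with the tangent
    vector \<open>w\<close>.\<close>
  have \<mu>_diff: "(\<lambda>t. \<mu> (c t)) differentiable (at 0)"
    unfolding \<mu>_def using \<nu>0 c(1) differentiableI_vector[OF nc] differentiableI_vector[OF \<nu>c]
    by (intro derivative_intros) auto
  then obtain \<mu>' where \<mu>': "((\<lambda>t. \<mu> (c t)) has_real_derivative \<mu>') (at 0)"
    using real_differentiable_def by blast
  have "((\<lambda>t. \<mu> (c t) *\<^sub>R \<nu> (c t)) has_vector_derivative \<mu> x *\<^sub>R H x v + \<mu>' *\<^sub>R \<nu> x) (at 0)"
    using has_vector_derivative_scaleR[OF \<mu>' \<nu>c] c(1) by simp
  moreover have "((\<lambda>t. \<mu> (c t) *\<^sub>R \<nu> (c t)) has_vector_derivative A v) (at 0)"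
  proof -
    have "\<forall>\<^sub>F t in at 0. c t \<in> U" "\<forall>\<^sub>F t in at 0. c t \<in> U'"
      using cx c(1) chartD(1) U' x by (auto simp: continuous_at intro: topological_tendstoD)
    moreover have "\<forall>\<^sub>F t in at 0. c t \<in> S"
      using e unfolding eventually_at by (auto simp: dist_real_def)
    ultimately have "\<forall>\<^sub>F t in at 0. n (c t) = \<mu> (c t) *\<^sub>R \<nu> (c t)"
      by eventually_elim (rule n_eq)
    moreover have "n (c 0) = \<mu> (c 0) *\<^sub>R \<nu> (c 0)" using n_eq c x U' by simp
    ultimately show ?thesis
      by (rule has_vector_derivative_transform_eventually[OF nc])
  qed
  ultimately have "A v = \<mu> x *\<^sub>R H x v + \<mu>' *\<^sub>R \<nu> x" by (metis vector_derivative_unique_at)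
  moreover have "\<nu> x \<bullet> w = 0" using chartD(5) x w by blast
  ultimately have "A v \<bullet> w = (H x v \<bullet> w) * \<mu> x" by (simp add: inner_add_left mult.commute)
  moreover have "(\<mu> x)\<^sup>2 = 1 / (\<nu> x \<bullet> \<nu> x)"
  proof -
    have "n x \<bullet> n x = 1" using n x U' by (simp add: norm_eq_1)
    then have "(\<mu> x)\<^sup>2 * (\<nu> x \<bullet> \<nu> x) = 1"
      using n_eq[OF x U'(2)] by (simp add: power2_eq_square mult.assoc)
    then show ?thesis using \<nu>0 by (simp add: field_simps)
  qed
  ultimately show "A v \<bullet> w = (H x v \<bullet> w) * ((n x \<bullet> \<nu> x) / (\<nu> x \<bullet> \<nu> x))"
    and "((n x \<bullet> \<nu> x) / (\<nu> x \<bullet> \<nu> x))\<^sup>2 = 1 / (\<nu> x \<bullet> \<nu> x)"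
    unfolding \<mu>_def by blast+
qed

text \<open>As \<open>gauss_curvature\<close> is a definite description, the formula must be the
  value for every admissible normal field and tangent basis (\<open>uniq\<close>), and some
  admissible choice must exist; the normalized \<nu> provides one.\<close>

lemma gauss_curvature_in_chart:
  assumes chart: "normal_chart S U \<nu> H" and x: "x \<in> S" "x \<in> U"
  obtains a b where "norm a = 1" "norm b = 1"
    "gauss_curvature S x =
      ((H x a \<bullet> a) * (H x b \<bullet> b) - (H x a \<bullet> b) * (H x b \<bullet> a)) / (\<nu> x \<bullet> \<nu> x)"
proof -
  note chartD = normal_chartD[OF chart]
  note \<nu>0 = chartD(2)[OF x(2)]
  obtain a b where ab: "norm a = 1" "norm b = 1" "a \<bullet> b = 0" "\<nu> x \<bullet> a = 0" "\<nu> x \<bullet> b = 0"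
    and expand: "\<And>v. \<nu> x \<bullet> v = 0 \<Longrightarrow> v = (v \<bullet> a) *\<^sub>R a + (v \<bullet> b) *\<^sub>R b"
    using orthonormal_pair_hyperplane[OF \<nu>0] by metis
  have tan: "v \<in> tangent_space S x \<longleftrightarrow> \<nu> x \<bullet> v = 0" for v using chartD(5) x by blast
  have lin: "linear (H x)" using chartD(3)[OF x(2)] by (rule has_derivative_linear)
  define k where "k = ((H x a \<bullet> a) * (H x b \<bullet> b) - (H x a \<bullet> b) * (H x b \<bullet> a)) / (\<nu> x \<bullet> \<nu> x)"
  have uniq: "k' = k" if "has_gauss_curvature S x k'" for k'
  proof -
    from that obtain n A U' a' b' where U': "open U'" "x \<in> U'"
      and n: "\<forall>y\<in>S \<inter> U'. norm (n y) = 1 \<and> (\<forall>v\<in>tangent_space S y. n y \<bullet> v = 0)"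
      and A: "(n has_derivative A) (at x within S)"
      and tan': "a' \<in> tangent_space S x" "b' \<in> tangent_space S x"
      and ab': "norm a' = 1" "norm b' = 1" "a' \<bullet> b' = 0"
      and k': "k' = (A a' \<bullet> a') * (A b' \<bullet> b') - (A a' \<bullet> b') * (A b' \<bullet> a')"
      unfolding has_gauss_curvature_def by (elim exE conjE) (rule that, auto)
    note A_eq = unit_normal_derivative_in_chart[OF chart x U' n A]
    define \<mu> where "\<mu> = (n x \<bullet> \<nu> x) / (\<nu> x \<bullet> \<nu> x)"
    have \<mu>: "\<mu>\<^sup>2 = 1 / (\<nu> x \<bullet> \<nu> x)" unfolding \<mu>_def by (rule A_eq(2)[OF tan'(1) tan'(1)])
    have Aw: "A v \<bullet> w = (H x v \<bullet> w) * \<mu>"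
      if "v \<in> tangent_space S x" "w \<in> tangent_space S x" for v w
      unfolding \<mu>_def by (rule A_eq(1)[OF that])
    have "k' = ((H x a' \<bullet> a') * (H x b' \<bullet> b') - (H x a' \<bullet> b') * (H x b' \<bullet> a')) * \<mu>\<^sup>2"
      using tan' by (simp add: k' Aw algebra_simps power2_eq_square)
    also have "(H x a' \<bullet> a') * (H x b' \<bullet> b') - (H x a' \<bullet> b') * (H x b' \<bullet> a')
      = (H x a \<bullet> a) * (H x b \<bullet> b) - (H x a \<bullet> b) * (H x b \<bullet> a)"
    proof -
      define q r s t where "q = a' \<bullet> a" "r = a' \<bullet> b" "s = b' \<bullet> a" "t = b' \<bullet> b"
      have a': "a' = q *\<^sub>R a + r *\<^sub>R b" and b': "b' = s *\<^sub>R a + t *\<^sub>R b"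
        using expand[of a'] expand[of b'] tan' by (auto simp: tan q_r_s_t_def)
      have one: "a \<bullet> a = 1" "b \<bullet> b = 1" "b \<bullet> a = 0"
        using ab by (simp_all add: norm_eq_1 inner_commute)
      have "q * q + r * r = 1" "s * s + t * t = 1" "q * s + r * t = 0"
        using ab' ab one unfolding norm_eq_1 a' b'
        by (simp_all add: inner_add_left inner_add_right mult.commute)
      \<comment> \<open>Lagrange's identity: the squared determinant equals
        \<open>(q * q + r * r) * (s * s + t * t) - (q * s + r * t)\<^sup>2\<close>. A change of
        basis multiplies the determinant of a bilinear form by exactly this square.\<close>
      then have det: "(q * t - r * s)\<^sup>2 = 1" by algebra
      have "(H x a' \<bullet> a') * (H x b' \<bullet> b') - (H x a' \<bullet> b') * (H x b' \<bullet> a')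
        = (q * t - r * s)\<^sup>2 * ((H x a \<bullet> a) * (H x b \<bullet> b) - (H x a \<bullet> b) * (H x b \<bullet> a))"
        unfolding a' b'
        by (simp add: linear_add[OF lin] linear_cmul[OF lin] inner_add_left inner_add_right) algebra
      then show ?thesis using det by simp
    qed
    finally show ?thesis by (simp add: k_def \<mu>)
  qed
  have "has_gauss_curvature S x k"
  proof -
    define n where "n y = inverse (norm (\<nu> y)) *\<^sub>R \<nu> y" for y
    have n: "\<forall>y\<in>S \<inter> U. norm (n y) = 1 \<and> (\<forall>v\<in>tangent_space S y. n y \<bullet> v = 0)"
      using chartD(2,5) by (auto simp: n_def)
    have \<nu>d: "\<nu> differentiable (at x)" using chartD(3)[OF x(2)] by (rule differentiableI)
    have "(norm \<circ> \<nu>) differentiable (at x)"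
      by (rule differentiable_chain_at[OF \<nu>d differentiable_norm_at[OF \<nu>0]])
    then have "n differentiable (at x)"
      unfolding n_def o_def using \<nu>0 \<nu>d
      by (intro differentiable_scaleR differentiable_inverse) auto
    then have "n differentiable (at x within S)" by (rule differentiable_at_withinI)
    then obtain A where A: "(n has_derivative A) (at x within S)"
      unfolding differentiable_def by blast
    note A_eq = unit_normal_derivative_in_chart[OF chart x chartD(1) x(2) n A]
    define \<mu> where "\<mu> = (n x \<bullet> \<nu> x) / (\<nu> x \<bullet> \<nu> x)"
    have tan': "a \<in> tangent_space S x" "b \<in> tangent_space S x" using ab tan by auto
    have \<mu>: "\<mu>\<^sup>2 = 1 / (\<nu> x \<bullet> \<nu> x)" unfolding \<mu>_def by (rule A_eq(2)[OF tan'(1) tan'(1)])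
    have Aw: "A v \<bullet> w = (H x v \<bullet> w) * \<mu>"
      if "v \<in> tangent_space S x" "w \<in> tangent_space S x" for v w
      unfolding \<mu>_def by (rule A_eq(1)[OF that])
    have "k = ((H x a \<bullet> a) * (H x b \<bullet> b) - (H x a \<bullet> b) * (H x b \<bullet> a)) * \<mu>\<^sup>2"
      by (simp add: k_def \<mu>)
    then have "k = (A a \<bullet> a) * (A b \<bullet> b) - (A a \<bullet> b) * (A b \<bullet> a)"
      using tan' by (simp add: Aw algebra_simps power2_eq_square)
    then show ?thesis unfolding has_gauss_curvature_def
      using chartD(1) x n A tan' ab by blast
  qed
  then have "gauss_curvature S x = k"
    unfolding gauss_curvature_def by (rule the_equality) (rule uniq)
  then show ?thesis using that ab unfolding k_def by blast
qed

text \<open>Each point has a neighbourhood on which the chart formula is bounded, and finitely many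
  of these cover \<open>S\<close>.\<close>

lemma gauss_curvature_bounded:
  assumes S: "compact S" "smooth_surface S"
  obtains M where "\<And>x. x \<in> S \<Longrightarrow> \<bar>gauss_curvature S x\<bar> \<le> M"
proof -
  have "\<exists>W M. open W \<and> q \<in> W \<and> (\<forall>x\<in>S \<inter> W. \<bar>gauss_curvature S x\<bar> \<le> M)" if qS: "q \<in> S" for q
  proof -
    obtain U \<nu> H where chart: "normal_chart S U \<nu> H" and q: "q \<in> U"
      using smooth_surface_normal_chart[OF S(2) qS] by blast
    note chartD = normal_chartD[OF chart]
    obtain r where r: "r > 0" "cball q r \<subseteq> U" using chartD(1) q open_contains_cball by blast
    have \<nu>c: "continuous_on U \<nu>"
      using chartD(3) has_derivative_continuous continuous_at_imp_continuous_on by blast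
    \<comment> \<open>The basis in the chart formula depends on the point in an uncontrolled way, so
      \<open>H\<close> is bounded over all unit vectors at once.\<close>
    have "continuous_on (cball q r \<times> sphere 0 1) (\<lambda>(x, v). H x v)"
      by (rule continuous_on_subset[OF chartD(4)]) (use r in auto)
    then have "compact ((\<lambda>(x, v). H x v) ` (cball q r \<times> sphere 0 1))"
      by (intro compact_continuous_image compact_Times) auto
    then obtain B where B: "\<And>x v. x \<in> cball q r \<Longrightarrow> norm v = 1 \<Longrightarrow> norm (H x v) \<le> B"
      by (force dest!: compact_imp_bounded simp: bounded_iff)
    have "continuous_on (cball q r) (\<lambda>x. 1 / (\<nu> x \<bullet> \<nu> x))"
      using r chartD(2) by (intro continuous_intros continuous_on_subset[OF \<nu>c]) auto
    then have "compact ((\<lambda>x. 1 / (\<nu> x \<bullet> \<nu> x)) ` cball q r)"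
      by (intro compact_continuous_image) auto
    then obtain C where C: "\<And>x. x \<in> cball q r \<Longrightarrow> \<bar>1 / (\<nu> x \<bullet> \<nu> x)\<bar> \<le> C"
      by (force dest!: compact_imp_bounded simp: bounded_iff)
    have "\<bar>gauss_curvature S x\<bar> \<le> (B * B + B * B) * C" if x: "x \<in> S" "x \<in> ball q r" for x
    proof -
      have xc: "x \<in> cball q r" "x \<in> U" using x r by auto
      obtain a b where ab: "norm a = 1" "norm b = 1"
        and k: "gauss_curvature S x =
          ((H x a \<bullet> a) * (H x b \<bullet> b) - (H x a \<bullet> b) * (H x b \<bullet> a)) / (\<nu> x \<bullet> \<nu> x)"
        using gauss_curvature_in_chart[OF chart x(1) xc(2)] by metis
      have le: "\<bar>H x v \<bullet> w\<bar> \<le> B" if "norm v = 1" "norm w = 1" for v w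
        using Cauchy_Schwarz_ineq2[of "H x v" w] B[OF xc(1) that(1)] that(2) by simp
      have B0: "B \<ge> 0" using le[OF ab] by simp
      have "\<bar>(H x a \<bullet> a) * (H x b \<bullet> b) - (H x a \<bullet> b) * (H x b \<bullet> a)\<bar> \<le>
          \<bar>(H x a \<bullet> a) * (H x b \<bullet> b)\<bar> + \<bar>(H x a \<bullet> b) * (H x b \<bullet> a)\<bar>" by simp
      also have "\<dots> \<le> B * B + B * B"
        unfolding abs_mult by (intro add_mono mult_mono le ab B0) auto
      finally have "\<bar>gauss_curvature S x\<bar> \<le> (B * B + B * B) * \<bar>1 / (\<nu> x \<bullet> \<nu> x)\<bar>"
        unfolding k by (simp add: divide_right_mono)
      also have "\<dots> \<le> (B * B + B * B) * C"
        using C[OF xc(1)] by (intro mult_left_mono) auto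
      finally show ?thesis .
    qed
    then show ?thesis using r by (intro exI[of _ "ball q r"] exI[of _ "(B * B + B * B) * C"]) auto
  qed
  then obtain W M where W: "\<And>q. q \<in> S \<Longrightarrow> open (W q) \<and> q \<in> W q"
    and M: "\<And>q x. q \<in> S \<Longrightarrow> x \<in> S \<Longrightarrow> x \<in> W q \<Longrightarrow> \<bar>gauss_curvature S x\<bar> \<le> M q"
    by (metis IntI)
  obtain C where C: "C \<subseteq> S" "finite C" "S \<subseteq> (\<Union>q\<in>C. W q)"
    using compactE_image[OF S(1), of S W] W by blast
  have "\<bar>gauss_curvature S x\<bar> \<le> (\<Sum>q\<in>C. \<bar>M q\<bar>)" if x: "x \<in> S" for x
  proof -
    obtain q where q: "q \<in> C" "x \<in> W q" using C x by blast
    have "\<bar>gauss_curvature S x\<bar> \<le> \<bar>M q\<bar>" using M[of q x] q C x by force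
    also have "\<dots> \<le> (\<Sum>q\<in>C. \<bar>M q\<bar>)" using q C by (intro member_le_sum) auto
    finally show ?thesis .
  qed
  with that show ?thesis by blast
qed

text \<open>The derivative of a parallel field is normal, hence a multiple of \<nu>; differentiating
  \<open>V s \<bullet> \<nu> (c s) = 0\<close> gives the factor. The derivative is thereby a
  function of the field, the velocity and the point alone.\<close>

lemma parallel_field_derivative_in_chart:
  assumes chart: "normal_chart S U \<nu> H"
    and c: "\<And>s. c s \<in> S" "(c has_vector_derivative c') (at s)" and cU: "c s \<in> U"
    and V: "\<And>s. V s \<in> tangent_space S (c s)" and par: "parallel_along S c V"
  shows "(V has_vector_derivative - ((V s \<bullet> H (c s) c') / (\<nu> (c s) \<bullet> \<nu> (c s))) *\<^sub>R \<nu> (c s)) (at s)"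
proof -
  note chartD = normal_chartD[OF chart]
  from par obtain w where w: "(V has_vector_derivative w) (at s)"
    "\<And>v. v \<in> tangent_space S (c s) \<Longrightarrow> w \<bullet> v = 0"
    unfolding parallel_along_def has_covariant_derivative_def by fastforce
  have \<nu>c: "((\<lambda>s. \<nu> (c s)) has_vector_derivative H (c s) c') (at s)"
    using vector_derivative_diff_chain_within[of c c' s UNIV \<nu> "H (c s)"] c chartD(3)[OF cU]
    by (auto simp: o_def intro: has_derivative_at_withinI)
  have "((\<lambda>s. V s \<bullet> \<nu> (c s)) has_vector_derivative (V s \<bullet> H (c s) c' + w \<bullet> \<nu> (c s))) (at s)"
    by (rule bounded_bilinear.has_vector_derivative[OF bounded_bilinear_inner w(1) \<nu>c])
  moreover have "((\<lambda>s. V s \<bullet> \<nu> (c s)) has_vector_derivative 0) (at s)"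
  proof -
    have "isCont c s" by (rule has_vector_derivative_continuous[OF c(2)])
    then have "\<forall>\<^sub>F t in at s. c t \<in> U"
      using chartD(1) cU by (auto simp: continuous_at intro: topological_tendstoD)
    then have "\<forall>\<^sub>F t in at s. 0 = V t \<bullet> \<nu> (c t)"
      by eventually_elim (metis V c(1) chartD(5) inner_commute)
    moreover have "0 = V s \<bullet> \<nu> (c s)" using V c(1) cU chartD(5) by (metis inner_commute)
    ultimately show ?thesis
      by (rule has_vector_derivative_transform_eventually[OF has_vector_derivative_const])
  qed
  ultimately have "V s \<bullet> H (c s) c' + w \<bullet> \<nu> (c s) = 0"
    by (rule vector_derivative_unique_at)
  then have w\<nu>: "w \<bullet> \<nu> (c s) = - (V s \<bullet> H (c s) c')" by simp
  \<comment> \<open>The part of \<open>w\<close> orthogonal to \<nu> is tangent; since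
    \<open>w\<close> is orthogonal to tangent vectors, this part vanishes.\<close>
  define z where "z = w - ((w \<bullet> \<nu> (c s)) / (\<nu> (c s) \<bullet> \<nu> (c s))) *\<^sub>R \<nu> (c s)"
  have "\<nu> (c s) \<bullet> \<nu> (c s) \<noteq> 0" using chartD(2)[OF cU] by simp
  then have z: "\<nu> (c s) \<bullet> z = 0" by (simp add: z_def inner_diff_right inner_commute)
  then have "z \<in> tangent_space S (c s)" using chartD(5) c cU by blast
  then have "w \<bullet> z = 0" by (rule w(2))
  then have "z \<bullet> z = 0"
    using z by (metis z_def inner_diff_left inner_scaleR_left diff_zero mult_zero_right)
  then have "w = - ((V s \<bullet> H (c s) c') / (\<nu> (c s) \<bullet> \<nu> (c s))) *\<^sub>R \<nu> (c s)"
    by (simp add: z_def w\<nu> eq_neg_iff_add_eq_0)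
  then show ?thesis using w(1) by simp
qed

lemma velocity_in_tangent_space:
  assumes "\<And>s. c s \<in> S" "(c has_vector_derivative v) (at s)"
  shows "v \<in> tangent_space S (c s)"
proof -
  have "((\<lambda>t. c (s + t)) has_vector_derivative v) (at 0)"
    using vector_diff_chain_at[of "\<lambda>t. s + t" 1 0 c v] assms(2)
      has_vector_derivative_add[OF has_vector_derivative_const has_vector_derivative_id, of s]
    by (simp add: o_def)
  then show ?thesis unfolding tangent_space_def using assms(1)
    by (intro CollectI exI[of _ "\<lambda>t. c (s + t)"] exI[of _ 1]) auto
qed

section \<open>Geodesic curvature of the conjugate locus\<close>

theorem mainTheorem3:
  fixes S :: "(real^3) set" and p e1 e2 :: "real^3"
    and X T N :: "real \<Rightarrow> real \<Rightarrow> real^3" and \<xi> :: "real \<Rightarrow> real \<Rightarrow> real"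
    and R \<sigma> :: "real \<Rightarrow> real" and \<psi> :: real
  assumes surface: "smooth_strictly_convex_surface S" and p: "p \<in> S"
    and frame: "e1 \<in> tangent_space S p" "e2 \<in> tangent_space S p"
      "norm e1 = 1" "norm e2 = 1" "e1 \<bullet> e2 = 0"
    and geodesics: "\<And>\<theta>. unit_speed_geodesic S (\<lambda>s. X s \<theta>)"
    and T_def: "\<And>s \<theta>. T s \<theta> = vector_derivative (\<lambda>s. X s \<theta>) (at s)"
    and initial: "\<And>\<theta>. X 0 \<theta> = p" "\<And>\<theta>. T 0 \<theta> = cos \<theta> *\<^sub>R e1 + sin \<theta> *\<^sub>R e2"
    and normal: "\<And>s \<theta>. N s \<theta> \<in> tangent_space S (X s \<theta>)" "\<And>s \<theta>. norm (N s \<theta>) = 1"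
      "\<And>s \<theta>. N s \<theta> \<bullet> T s \<theta> = 0" "\<And>\<theta>. parallel_along S (\<lambda>s. X s \<theta>) (\<lambda>s. N s \<theta>)"
    and jacobi: "\<And>\<theta>. scalar_jacobi S (\<lambda>s. X s \<theta>) (\<lambda>s. \<xi> s \<theta>)"
      "\<And>\<theta>. \<xi> 0 \<theta> = 0" "\<And>\<theta>. deriv (\<lambda>s. \<xi> s \<theta>) 0 = 1"
    and jacobi_field: "\<And>s \<theta>. ((\<lambda>\<theta>. X s \<theta>) has_vector_derivative \<xi> s \<theta> *\<^sub>R N s \<theta>) (at \<theta>)"
    and R: "\<And>\<theta>. is_first_positive_zero (\<lambda>s. \<xi> s \<theta>) (R \<theta>)"
    and R_deriv: "R differentiable (at \<psi>)" "deriv R \<psi> \<noteq> 0"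
    and arc_length: "(\<sigma> has_real_derivative deriv R \<psi>) (at \<psi>)"
  shows "has_geodesic_curvature S (\<lambda>\<theta>. X (R \<theta>) \<theta>) (\<lambda>\<theta>. T (R \<theta>) \<theta>) (\<lambda>\<theta>. N (R \<theta>) \<theta>) \<sigma> \<psi>
    (deriv (\<lambda>s. \<xi> s \<psi>) (R \<psi>) / deriv R \<psi>)"
proof -
  define s0 where "s0 = R \<psi>"
  have R0: "s0 > 0" "\<xi> s0 \<psi> = 0"
    using R[of \<psi>] by (auto simp: is_first_positive_zero_def s0_def)
  have R': "(R has_real_derivative deriv R \<psi>) (at \<psi>)"
    using R_deriv(1) by (simp add: DERIV_deriv_iff_real_differentiable)
  have S: "compact S" "smooth_surface S"
    using surface by (auto simp: smooth_strictly_convex_surface_def)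

  \<comment> \<open>Radial geodesics near the conjugate point\<close>
  have XS: "X s \<theta> \<in> S" and dX: "((\<lambda>s. X s \<theta>) has_vector_derivative T s \<theta>) (at s)"
    and T1: "norm (T s \<theta>) = 1" and parT: "parallel_along S (\<lambda>s. X s \<theta>) (\<lambda>s. T s \<theta>)" for s \<theta>
    using geodesics[of \<theta>] by (simp_all add: unit_speed_geodesic_def T_def vector_derivative_works)
  have tanT: "T s \<theta> \<in> tangent_space S (X s \<theta>)" for s \<theta>
    by (rule velocity_in_tangent_space[OF XS dX])

  obtain U \<nu> H where chart: "normal_chart S U \<nu> H" and x0: "X s0 \<psi> \<in> U"
    using smooth_surface_normal_chart[OF S(2) XS] by blast
  note chartD = normal_chartD[OF chart]
  obtain r where r: "r > 0" "cball (X s0 \<psi>) r \<subseteq> U"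
    using chartD(1) x0 open_contains_cball by blast
  have "isCont (\<lambda>\<theta>. X s0 \<theta>) \<psi>"
    using has_vector_derivative_continuous[OF jacobi_field] .
  \<comment> \<open>Half of \<open>r\<close> is spent on varying \<theta> at \<open>s0\<close>, the
    other half on moving along a unit speed geodesic for a time below \<open>r / 2\<close>.\<close>
  then obtain d where d: "d > 0" "\<And>\<theta>. \<theta> \<in> ball \<psi> d \<Longrightarrow> dist (X s0 \<theta>) (X s0 \<psi>) < r / 2"
    using r(1) unfolding continuous_at_eps_delta
    by (metis half_gt_zero mem_ball dist_commute)
  have near: "X s \<theta> \<in> cball (X s0 \<psi>) r" if "\<bar>s - s0\<bar> < r / 2" "\<theta> \<in> ball \<psi> d" for s \<theta>
  proof -
    have "norm (X s \<theta> - X s0 \<theta>) \<le> 1 * \<bar>s - s0\<bar>"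
      using that(1) T1
      by (intro has_vector_derivative_bound[where r = "r / 2" and f' = "\<lambda>t. T t \<theta>"] dX)
        (auto simp: dist_real_def abs_minus_commute)
    then show ?thesis
      using that(1) d(2)[OF that(2)] dist_triangle[of "X s \<theta>" "X s0 \<psi>" "X s0 \<theta>"]
      by (simp add: dist_norm norm_minus_commute)
  qed
  have limX: "uniform_limit (ball \<psi> d) X (X s0) (at s0)"
    by (rule bounded_derivative_uniform_limit[where r = 1 and B = 1]) (use dX T1 in auto)

  \<comment> \<open>Unit parallel fields \<open>V\<close> satisfy \<open>V\<^sub>s = F (V, T, X)\<close> in the chart; uniform continuity of \<open>F\<close> on
    the compact set \<open>C\<close> is what makes \<open>T\<^sub>s\<close> and \<open>N\<^sub>s\<close> continuous in \<open>s\<close> uniformly in \<open>\<theta>\<close>.\<close>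
  define F where "F = (\<lambda>(u, v, x). - ((u \<bullet> H x v) / (\<nu> x \<bullet> \<nu> x)) *\<^sub>R \<nu> x)"
  define C where "C = sphere (0 :: real^3) 1 \<times> sphere (0 :: real^3) 1 \<times> cball (X s0 \<psi>) r"
  have F_cont: "continuous_on (UNIV \<times> UNIV \<times> U) F"
  proof -
    have "continuous_on U \<nu>"
      using chartD(3) has_derivative_continuous continuous_at_imp_continuous_on by blast
    moreover have "continuous_on (UNIV \<times> UNIV \<times> U) (\<lambda>z. H (snd (snd z)) (fst (snd z)))"
      using continuous_on_compose2[OF chartD(4), of "UNIV \<times> UNIV \<times> U" "\<lambda>z. (snd (snd z), fst (snd z))"]
      by (force intro: continuous_intros)
    ultimately show ?thesis
      unfolding F_def case_prod_unfold using chartD(2)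
      by (intro continuous_intros) (auto intro!: continuous_on_compose2[of U \<nu>] continuous_intros)
  qed
  have C_sub: "C \<subseteq> UNIV \<times> UNIV \<times> U" using r by (auto simp: C_def)
  have "compact C" unfolding C_def by (intro compact_Times) auto
  then have F_unif: "uniformly_continuous_on C F" and "compact (F ` C)"
    using continuous_on_subset[OF F_cont C_sub]
    by (auto intro: compact_uniformly_continuous compact_continuous_image)
  then obtain B where B: "\<And>z. z \<in> C \<Longrightarrow> norm (F z) \<le> B"
    by (force dest!: compact_imp_bounded simp: bounded_iff)

  \<comment> \<open>Uniform limits of parallel fields and their derivatives\<close>
  have parallel_field:
    "((\<lambda>s. V s \<theta>) has_vector_derivative vector_derivative (\<lambda>s. V s \<theta>) (at s)) (at s) \<and>
     (\<bar>s - s0\<bar> < r / 2 \<longrightarrow> \<theta> \<in> ball \<psi> d \<longrightarrow>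
       vector_derivative (\<lambda>s. V s \<theta>) (at s) = F (V s \<theta>, T s \<theta>, X s \<theta>) \<and> (V s \<theta>, T s \<theta>, X s \<theta>) \<in> C)"
    if V: "\<And>s \<theta>. V s \<theta> \<in> tangent_space S (X s \<theta>)" "\<And>s \<theta>. norm (V s \<theta>) = 1"
      "\<And>\<theta>. parallel_along S (\<lambda>s. X s \<theta>) (\<lambda>s. V s \<theta>)" for V s \<theta>
  proof (intro conjI impI)
    have "(\<lambda>s. V s \<theta>) differentiable (at s)"
      using V(3)[of \<theta>] differentiableI_vector
      unfolding parallel_along_def has_covariant_derivative_def by blast
    then show "((\<lambda>s. V s \<theta>) has_vector_derivative vector_derivative (\<lambda>s. V s \<theta>) (at s)) (at s)"
      by (simp add: vector_derivative_works)
    assume s: "\<bar>s - s0\<bar> < r / 2" and \<theta>: "\<theta> \<in> ball \<psi> d"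
    have "X s \<theta> \<in> U" using near[OF s \<theta>] r by blast
    from parallel_field_derivative_in_chart[OF chart XS dX this V(1) V(3)]
    show "vector_derivative (\<lambda>s. V s \<theta>) (at s) = F (V s \<theta>, T s \<theta>, X s \<theta>)"
      unfolding F_def by (simp add: vector_derivative_at)
    show "(V s \<theta>, T s \<theta>, X s \<theta>) \<in> C" using V(2) T1 near[OF s \<theta>] by (simp add: C_def)
  qed
  have limV: "uniform_limit (ball \<psi> d) V (V s0) (at s0)"
    if V: "\<And>s \<theta>. V s \<theta> \<in> tangent_space S (X s \<theta>)" "\<And>s \<theta>. norm (V s \<theta>) = 1"
      "\<And>\<theta>. parallel_along S (\<lambda>s. X s \<theta>) (\<lambda>s. V s \<theta>)" for V
  proof (rule bounded_derivative_uniform_limit[where r = "r / 2" and B = B])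
    show "((\<lambda>s. V s \<theta>) has_vector_derivative vector_derivative (\<lambda>s. V s \<theta>) (at s)) (at s)" for s \<theta>
      using parallel_field[OF V] by blast
    show "norm (vector_derivative (\<lambda>s. V s \<theta>) (at s)) \<le> B"
      if "\<bar>s - s0\<bar> < r / 2" "\<theta> \<in> ball \<psi> d" for s \<theta>
      using parallel_field[OF V, of \<theta> s] B that by auto
  qed (use r in auto)
  have limT: "uniform_limit (ball \<psi> d) T (T s0) (at s0)" by (rule limV[OF tanT T1 parT])
  \<comment> \<open>The triple \<open>(V, T, X)\<close> converges uniformly by \<open>limV\<close>,
    \<open>limT\<close> and \<open>limX\<close>; composing with the uniformly continuous
    \<open>F\<close> preserves this.\<close>
  have limV': "uniform_limit (ball \<psi> d) (\<lambda>s \<theta>. vector_derivative (\<lambda>s. V s \<theta>) (at s))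
      (\<lambda>\<theta>. vector_derivative (\<lambda>s. V s \<theta>) (at s0)) (at s0)"
    if V: "\<And>s \<theta>. V s \<theta> \<in> tangent_space S (X s \<theta>)" "\<And>s \<theta>. norm (V s \<theta>) = 1"
      "\<And>\<theta>. parallel_along S (\<lambda>s. X s \<theta>) (\<lambda>s. V s \<theta>)" for V
  proof -
    have ev: "\<forall>\<^sub>F s in at s0. \<bar>s - s0\<bar> < r / 2"
      using r unfolding eventually_at by (auto simp: dist_real_def intro!: exI[of _ "r / 2"])
    have "uniform_limit (ball \<psi> d) (\<lambda>s \<theta>. F (V s \<theta>, T s \<theta>, X s \<theta>)) (\<lambda>\<theta>. F (V s0 \<theta>, T s0 \<theta>, X s0 \<theta>)) (at s0)"
    proof (rule uniform_limit_compose_uniformly_continuous_on[OF _ F_unif])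
      show "uniform_limit (ball \<psi> d) (\<lambda>s \<theta>. (V s \<theta>, T s \<theta>, X s \<theta>)) (\<lambda>\<theta>. (V s0 \<theta>, T s0 \<theta>, X s0 \<theta>)) (at s0)"
        by (intro uniform_limit_Pair limV[OF V] limT limX)
      show "\<forall>\<^sub>F s in at s0. \<forall>\<theta>\<in>ball \<psi> d. (V s \<theta>, T s \<theta>, X s \<theta>) \<in> C"
        using ev by eventually_elim (use parallel_field[OF V] in blast)
    qed (use \<open>compact C\<close> compact_imp_closed in blast)
    then show ?thesis
    proof (rule uniform_limit_cong[THEN iffD1, rotated -1])
      show "\<forall>\<^sub>F s in at s0. \<forall>\<theta>\<in>ball \<psi> d. F (V s \<theta>, T s \<theta>, X s \<theta>) = vector_derivative (\<lambda>s. V s \<theta>) (at s)"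
        using ev by eventually_elim (use parallel_field[OF V] in force)
      show "F (V s0 \<theta>, T s0 \<theta>, X s0 \<theta>) = vector_derivative (\<lambda>s. V s \<theta>) (at s0)" if "\<theta> \<in> ball \<psi> d" for \<theta>
        using parallel_field[OF V, of \<theta> s0] that r by force
    qed
  qed
  define Ts where "Ts s \<theta> = vector_derivative (\<lambda>s. T s \<theta>) (at s)" for s \<theta>
  define Ns where "Ns s \<theta> = vector_derivative (\<lambda>s. N s \<theta>) (at s)" for s \<theta>
  define \<xi>s where "\<xi>s s \<theta> = deriv (\<lambda>s. \<xi> s \<theta>) s" for s \<theta>
  note fieldT = parallel_field[OF tanT T1 parT, folded Ts_def]
  note fieldN = parallel_field[OF normal(1,2,4), folded Ns_def]
  have limTs: "uniform_limit (ball \<psi> d) Ts (Ts s0) (at s0)"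
    using limV'[OF tanT T1 parT] unfolding Ts_def[symmetric] .
  have limNs: "uniform_limit (ball \<psi> d) Ns (Ns s0) (at s0)"
    using limV'[OF normal(1,2,4)] unfolding Ns_def[symmetric] .
  \<comment> \<open>A product of uniform limits converges uniformly when the limit functions are
    bounded; this bound serves the term \<open>\<xi> N\<^sub>s\<close>.\<close>
  have bdNs: "bounded (Ns s0 ` ball \<psi> d)"
    using fieldN[of _ s0] B r by (intro boundedI[of _ B]) auto

  \<comment> \<open>Bounds for the Jacobi functions uniform in the angle\<close>
  obtain M where M: "\<And>x. x \<in> S \<Longrightarrow> \<bar>gauss_curvature S x\<bar> \<le> M"
    using gauss_curvature_bounded[OF S] by blast
  have M0: "M \<ge> 0" using M[OF p] by linarith
  \<comment> \<open>The energy bound at the right end of the window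
    \<open>\<bar>s - s0\<bar> < min 1 s0\<close>; the minimum with \<open>s0\<close> keeps
    \<open>s\<close> positive, where the energy estimate applies.\<close>
  define Z where "Z = sqrt (exp ((1 + M) * (s0 + 1)))"
  have d\<xi>: "((\<lambda>s. \<xi> s \<theta>) has_vector_derivative \<xi>s s \<theta>) (at s)"
    and d\<xi>s: "((\<lambda>s. \<xi>s s \<theta>) has_vector_derivative - gauss_curvature S (X s \<theta>) * \<xi> s \<theta>) (at s)" for s \<theta>
    using jacobi(1)[of \<theta>] unfolding scalar_jacobi_def \<xi>s_def
    by (simp_all flip: has_real_derivative_iff_has_vector_derivative add: DERIV_deriv_iff_real_differentiable)
  have bound: "\<bar>\<xi> s \<theta>\<bar> \<le> Z" "\<bar>\<xi>s s \<theta>\<bar> \<le> Z" if s: "\<bar>s - s0\<bar> < min 1 s0" for s \<theta>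
  proof -
    have "(\<xi> s \<theta>)\<^sup>2 + (\<xi>s s \<theta>)\<^sup>2 \<le> exp ((1 + M) * s)"
      unfolding \<xi>s_def using jacobi[of \<theta>] M[OF XS] s
      by (intro scalar_jacobi_bound[where k = "\<lambda>s. gauss_curvature S (X s \<theta>)"])
        (auto simp: scalar_jacobi_def)
    also have "\<dots> \<le> exp ((1 + M) * (s0 + 1))"
      using s M0 by (simp add: abs_less_iff)
    finally have "\<bar>\<xi> s \<theta>\<bar>\<^sup>2 \<le> exp ((1 + M) * (s0 + 1))" "\<bar>\<xi>s s \<theta>\<bar>\<^sup>2 \<le> exp ((1 + M) * (s0 + 1))"
      unfolding power2_abs using zero_le_power2[of "\<xi> s \<theta>"] zero_le_power2[of "\<xi>s s \<theta>"]
      by linarith+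
    then show "\<bar>\<xi> s \<theta>\<bar> \<le> Z" "\<bar>\<xi>s s \<theta>\<bar> \<le> Z" unfolding Z_def by (blast intro: real_le_rsqrt)+
  qed
  have lim\<xi>: "uniform_limit (ball \<psi> d) \<xi> (\<xi> s0) (at s0)"
    by (rule bounded_derivative_uniform_limit[where r = "min 1 s0" and B = Z])
      (use d\<xi> bound R0 in auto)
  have lim\<xi>s: "uniform_limit (ball \<psi> d) \<xi>s (\<xi>s s0) (at s0)"
  proof (rule bounded_derivative_uniform_limit[where r = "min 1 s0" and B = "M * Z", OF d\<xi>s])
    show "norm (- gauss_curvature S (X s \<theta>) * \<xi> s \<theta>) \<le> M * Z" if "\<bar>s - s0\<bar> < min 1 s0" for s \<theta>
      using mult_mono[OF M[OF XS] bound(1)[OF that]] M0 by (simp add: abs_mult)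
  qed (use R0 in auto)

  \<comment> \<open>Angular derivative of the unit tangent at the conjugate point\<close>
  have dT: "(T s0 has_vector_derivative \<xi>s s0 \<psi> *\<^sub>R N s0 \<psi>) (at \<psi>)"
  proof -
    have "(T s0 has_vector_derivative \<xi> s0 \<psi> *\<^sub>R Ns s0 \<psi> + \<xi>s s0 \<psi> *\<^sub>R N s0 \<psi>) (at \<psi>)"
    proof (rule mixed_partial_derivative[OF jacobi_field _ dX _ d(1),
          where D = "\<lambda>s \<theta>. \<xi> s \<theta> *\<^sub>R Ns s \<theta> + \<xi>s s \<theta> *\<^sub>R N s \<theta>"])
      show "((\<lambda>s. \<xi> s \<theta> *\<^sub>R N s \<theta>) has_vector_derivative \<xi> s \<theta> *\<^sub>R Ns s \<theta> + \<xi>s s \<theta> *\<^sub>R N s \<theta>) (at s)" for s \<theta>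
        using d\<xi>[of \<theta> s] fieldN[of \<theta> s]
        by (intro has_vector_derivative_scaleR)
          (simp_all add: has_real_derivative_iff_has_vector_derivative)
      show "uniform_limit (ball \<psi> d) (\<lambda>s \<theta>. \<xi> s \<theta> *\<^sub>R Ns s \<theta> + \<xi>s s \<theta> *\<^sub>R N s \<theta>)
          (\<lambda>\<theta>. \<xi> s0 \<theta> *\<^sub>R Ns s0 \<theta> + \<xi>s s0 \<theta> *\<^sub>R N s0 \<theta>) (at s0)"
        using bound[of s0] R0 normal(2)
        by (intro uniform_limit_add bounded_bilinear.bounded_uniform_limit[OF bounded_bilinear_scaleR]
            lim\<xi> lim\<xi>s limNs limV[OF normal(1,2,4)] bdNs) (auto intro: boundedI[of _ Z] boundedI[of _ 1])
    qed
    then show ?thesis by (simp add: R0)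
  qed
  have contT: "isCont (T s0) \<psi>" using has_vector_derivative_continuous[OF dT] .
  \<comment> \<open>\<open>Ts s0\<close> equals \<open>F\<close> applied to the tangent and the
    position, and \<open>T s0\<close> is continuous at \<psi> because \<open>dT\<close> makes it
    differentiable there.\<close>
  have contTs: "isCont (Ts s0) \<psi>"
  proof -
    have "isCont (\<lambda>\<theta>. F (T s0 \<theta>, T s0 \<theta>, X s0 \<theta>)) \<psi>"
    proof (rule isCont_o2[where f = "\<lambda>\<theta>. (T s0 \<theta>, T s0 \<theta>, X s0 \<theta>)"])
      show "isCont (\<lambda>\<theta>. (T s0 \<theta>, T s0 \<theta>, X s0 \<theta>)) \<psi>"
        using contT \<open>isCont (\<lambda>\<theta>. X s0 \<theta>) \<psi>\<close> by (intro continuous_intros)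
      show "isCont F (T s0 \<psi>, T s0 \<psi>, X s0 \<psi>)"
        using F_cont chartD(1) x0 by (subst (asm) continuous_on_eq_continuous_at) (auto intro: open_Times)
    qed
    moreover have "\<forall>\<^sub>F \<theta> in nhds \<psi>. F (T s0 \<theta>, T s0 \<theta>, X s0 \<theta>) = Ts s0 \<theta>"
      unfolding eventually_nhds using fieldT[of _ s0] r d(1)
      by (intro exI[of _ "ball \<psi> d"]) force
    ultimately show ?thesis by (simp cong: isCont_cong)
  qed

  \<comment> \<open>Derivatives along the conjugate locus\<close>
  have "((\<lambda>\<theta>. X (R \<theta>) \<theta>) has_vector_derivative deriv R \<psi> *\<^sub>R T (R \<psi>) \<psi> + \<xi> (R \<psi>) \<psi> *\<^sub>R N (R \<psi>) \<psi>) (at \<psi>)"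
    by (rule derivative_along_graph[OF dX limT[unfolded s0_def] d(1) contT[unfolded s0_def] jacobi_field R'])
  then have dbeta: "((\<lambda>\<theta>. X (R \<theta>) \<theta>) has_vector_derivative deriv R \<psi> *\<^sub>R T (R \<psi>) \<psi>) (at \<psi>)"
    using R0 by (simp add: s0_def)
  have "((\<lambda>\<theta>. T (R \<theta>) \<theta>) has_vector_derivative deriv R \<psi> *\<^sub>R Ts (R \<psi>) \<psi> + \<xi>s (R \<psi>) \<psi> *\<^sub>R N (R \<psi>) \<psi>) (at \<psi>)"
    using fieldT
    by (intro derivative_along_graph[where F = T and G = Ts and d = d] R' d(1)
          limTs[unfolded s0_def] contTs[unfolded s0_def] dT[unfolded s0_def]) blast
  moreover have "\<xi>s (R \<psi>) \<psi> *\<^sub>R N (R \<psi>) \<psi> \<in> tangent_space S (X (R \<psi>) \<psi>)"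
    using normal(1)[of "R \<psi>" \<psi>] chartD(5)[OF XS x0] by (simp add: s0_def)
  \<comment> \<open>In the chart \<open>Ts\<close> is a multiple of \<nu>, so the projection to the
    tangent plane removes the term with \<open>deriv R \<psi>\<close> and leaves
    \<open>\<xi>s\<close> times \<open>N\<close>.\<close>
  moreover have "Ts (R \<psi>) \<psi> \<bullet> v = 0" if "v \<in> tangent_space S (X (R \<psi>) \<psi>)" for v
    using fieldT[of \<psi> s0] that r d(1) chartD(5)[OF XS x0] by (simp add: s0_def F_def)
  ultimately have "has_covariant_derivative S (\<lambda>\<theta>. X (R \<theta>) \<theta>) (\<lambda>\<theta>. T (R \<theta>) \<theta>) \<psi> (\<xi>s (R \<psi>) \<psi> *\<^sub>R N (R \<psi>) \<psi>)"
    unfolding has_covariant_derivative_def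
    by (intro exI[of _ "deriv R \<psi> *\<^sub>R Ts (R \<psi>) \<psi> + \<xi>s (R \<psi>) \<psi> *\<^sub>R N (R \<psi>) \<psi>"]) auto
  then show ?thesis
    unfolding has_geodesic_curvature_def using arc_length R_deriv(2) dbeta
    by (intro exI[of _ "deriv R \<psi>"] exI[of _ "\<xi>s (R \<psi>) \<psi> *\<^sub>R N (R \<psi>) \<psi>"])
      (simp add: \<xi>s_def divide_inverse mult.commute)
qed

end
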